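(* As $n\to\infty$, \[\sigma\overline{\mathrm{mex}}(n) \sim \frac{e^{\pi\sqrt{n}}}{8n^{3/4}}.\]
   Context: An overpartition of $n$ is a non-increasing sequence of positive integers summing to $n$ in which the first occurrence of each distinct part may be overlined. For an overpartition $\pi$, $\overline{\mathrm{mex}}(\pi)$ is the smallest positive integer that does not occur among the non-overlined parts of $\pi$. For a positive integer $n$, $\sigma\overline{\mathrm{mex}}(n)=\sum_{\pi}\overline{\mathrm{mex}}(\pi)$, the sum over all overpartitions $\pi$ of $n$. *)

theory Defs
  imports "HOL-Analysis.Analysis" "HOL-Library.Landau_Symbols"
begin

text \<open>A part is a pair \<open>(k, b)\<close> of its size \<open>k\<close> and a flag \<open>b\<close> telling whether it is
  overlined.\<close>

definition is_overpartition :: "nat \<Rightarrow> (nat \<times> bool) list \<Rightarrow> bool" where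
  "is_overpartition n xs \<longleftrightarrow>
     sorted_wrt (\<ge>) (map fst xs) \<and>
     (\<forall>x \<in> set xs. fst x > 0) \<and>
     sum_list (map fst xs) = n \<and>
     (\<forall>i < length xs. snd (xs ! i) \<longrightarrow> (\<forall>j < i. fst (xs ! j) \<noteq> fst (xs ! i)))"

definition overpartitions :: "nat \<Rightarrow> (nat \<times> bool) list set" where
  "overpartitions n = {xs. is_overpartition n xs}"

definition overline_mex :: "(nat \<times> bool) list \<Rightarrow> nat" where
  "overline_mex xs = (LEAST m. m > 0 \<and> (m, False) \<notin> set xs)"

definition sigma_overline_mex :: "nat \<Rightarrow> nat" where
  "sigma_overline_mex n = (\<Sum>xs \<in> overpartitions n. overline_mex xs)"

text \<open>The sum in \<open>sigma_overline_mex\<close> ranges over a finite set, and the minimum in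
  \<open>overline_mex\<close> exists.\<close>

lemma finite_overpartitions: "finite (overpartitions n)"
proof (rule finite_subset)
  show "overpartitions n \<subseteq> {xs. set xs \<subseteq> {..n} \<times> UNIV \<and> length xs \<le> n}"
  proof
    fix xs assume "xs \<in> overpartitions n"
    then have pos: "\<forall>x \<in> set xs. fst x > 0" and sum: "sum_list (map fst xs) = n"
      by (auto simp: overpartitions_def is_overpartition_def)
    have "length xs \<le> sum_list (map fst xs)"
      using pos by (induction xs) auto
    moreover have "fst x \<le> n" if "x \<in> set xs" for x
      using that sum member_le_sum_list[of "fst x" "map fst xs"] by auto
    ultimately show "xs \<in> {xs. set xs \<subseteq> {..n} \<times> UNIV \<and> length xs \<le> n}"
      using sum by auto
  qed
  show "finite {xs. set xs \<subseteq> {..n} \<times> (UNIV :: bool set) \<and> length xs \<le> n}"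
    by (rule finite_lists_length_le) simp
qed

lemma overline_mex_exists: "\<exists>m > 0. (m, b) \<notin> set (xs :: (nat \<times> bool) list)"
proof -
  obtain m where "m \<notin> insert 0 (fst ` set xs)"
    using ex_new_if_finite[of "insert 0 (fst ` set xs)"] by (auto simp: infinite_UNIV_nat)
  then show ?thesis by (intro exI[of _ m]) (force simp: image_iff)
qed

end

theory Submission
  imports Defs "HOL-Probability.Sinc_Integral" "HOL-Real_Asymp.Real_Asymp"
begin

text \<open>Counting the overpartitions whose non-overlined parts contain \<open>1, \<dots>, m\<close> and summing over \<open>m\<close>,
  the generating function of \<open>\<sigma>mex\<close> is \<open>\<Sum>\<^sub>m q\<^bsup>m(m+1)/2\<^esup> \<cdot> \<Prod>\<^sub>k (1 + q\<^sup>k) / (1 - q\<^sup>k)\<close>. By Gauss' identity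
  \<open>\<Sum>\<^sub>m q\<^bsup>m(m+1)/2\<^esup> = \<Prod>\<^sub>k (1 - q\<^bsup>2k\<^esup>) / (1 - q\<^bsup>2k-1\<^esup>)\<close>, which is the limit of a finite identity of Shanks,
  this is \<open>\<Prod>\<^sub>k (1 + q\<^sup>k)\<^sup>3\<close>. The coefficient of \<open>q\<^sup>n\<close> is a Fourier integral over the circle of
  radius \<open>exp (- x)\<close> with the saddle point \<open>x = \<pi> / (2 \<surd>n)\<close>. On the scale \<open>y = s x\<^bsup>3/2\<^esup>\<close> of the angle, the
  expansion \<open>\<Sum>\<^sub>k ln (1 + exp (- k t)) = \<pi>\<^sup>2 / (12 t) - ln 2 / 2 + o(1)\<close> turns the integrand into a Gaussian,
  and the bound \<open>exp (- c \<Sum>\<^sub>k (1 - cos (k y)))\<close> over \<open>k \<le> 1/x\<close> gives an integrable majorant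
  \<open>C / (1 + s\<^sup>2)\<close> on the whole circle.\<close>

section \<open>The generating function\<close>

text \<open>An infinite level set would have \<open>card\<close> 0, so a coefficient is a genuine
  count only where the weight is attained finitely often; hence the finiteness hypotheses of the
  product rule.\<close>

definition weight_fps :: "('a \<Rightarrow> nat) \<Rightarrow> 'a set \<Rightarrow> complex fps" where
  "weight_fps w A = Abs_fps (\<lambda>n. of_nat (card {x \<in> A. w x = n}))"

lemma weight_fps_times:
  assumes "\<And>n. finite {x \<in> A. w x = n}" "\<And>n. finite {y \<in> B. v y = n}"
  shows "weight_fps (\<lambda>(x, y). w x + v y) (A \<times> B) = weight_fps w A * weight_fps v B"
proof (rule fps_ext)
  fix n
  have "{z \<in> A \<times> B. (case z of (x, y) \<Rightarrow> w x + v y) = n}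
      = (\<Union>i\<in>{0..n}. {x \<in> A. w x = i} \<times> {y \<in> B. v y = n - i})"
    by auto
  moreover have "card \<dots> = (\<Sum>i=0..n. card ({x \<in> A. w x = i} \<times> {y \<in> B. v y = n - i}))"
    using assms by (intro card_UN_disjoint) auto
  ultimately show "fps_nth (weight_fps (\<lambda>(x, y). w x + v y) (A \<times> B)) n = fps_nth (weight_fps w A * weight_fps v B) n"
    by (simp add: weight_fps_def fps_mult_nth card_cartesian_product)
qed

lemma weight_fps_bij_betw:
  assumes "bij_betw f A B" "\<And>x. x \<in> A \<Longrightarrow> v (f x) = w x"
  shows "weight_fps w A = weight_fps v B"
proof (rule fps_ext)
  fix n
  have "bij_betw f {x \<in> A. w x = n} {y \<in> B. v y = n}"
    using assms unfolding bij_betw_def by (auto simp: inj_on_def image_iff)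
  then show "fps_nth (weight_fps w A) n = fps_nth (weight_fps v B) n"
    using bij_betw_same_card by (fastforce simp: weight_fps_def)
qed

lemma inverse_one_minus_fps_X_power:
  assumes "k > 0"
  shows "(1 - fps_X ^ k) * inverse (1 - fps_X ^ k :: complex fps) = 1"
  using assms by (intro inverse_mult_eq_1') simp

lemma weight_fps_multiples:
  assumes "k > 0"
  shows "weight_fps (\<lambda>a. a * k) UNIV = inverse (1 - fps_X ^ k)"
proof -
  have nth: "fps_nth (weight_fps (\<lambda>a. a * k) UNIV) n = of_bool (k dvd n)" for n
  proof -
    have "{a. a * k = n} = (if k dvd n then {n div k} else {})"
      using assms by auto
    then show ?thesis by (simp add: weight_fps_def)
  qed
  have "weight_fps (\<lambda>a. a * k) UNIV * (1 - fps_X ^ k) = 1"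
  proof (rule fps_ext)
    fix n
    show "fps_nth (weight_fps (\<lambda>a. a * k) UNIV * (1 - fps_X ^ k)) n = fps_nth 1 n"
    proof (cases "n < k")
      case True
      then show ?thesis 
        by (auto simp: right_diff_distrib nth fps_X_power_mult_right_nth dest: dvd_imp_le)
    next
      case False
      moreover then have "k dvd n - k \<longleftrightarrow> k dvd n" by (simp add: dvd_minus_self)
      ultimately show ?thesis using assms
        by (auto simp: right_diff_distrib nth fps_X_power_mult_right_nth)
    qed
  qed
  then have "weight_fps (\<lambda>a. a * k) UNIV * ((1 - fps_X ^ k) * inverse (1 - fps_X ^ k)) = inverse (1 - fps_X ^ k)"
    by (simp add: mult.assoc[symmetric])
  then show ?thesis using inverse_one_minus_fps_X_power[OF assms] by simp
qed

lemma weight_fps_positive_multiples: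
  assumes "k > 0"
  shows "weight_fps (\<lambda>a. a * k) {a. a \<ge> 1} = fps_X ^ k * inverse (1 - fps_X ^ k)"
proof -
  \<comment> \<open>A compulsory copy of \<open>k\<close> is split off as the one-point factor
    \<open>{()}\<close> of weight \<open>k\<close>, so that the product rule yields
    \<open>fps_X ^ k\<close>.\<close>
  have "weight_fps (\<lambda>(_, a). k + a * k) ({()} \<times> UNIV) = weight_fps (\<lambda>a. a * k) {a. a \<ge> 1}"
    by (rule weight_fps_bij_betw[of "\<lambda>(_, a). Suc a"])
      (auto simp: bij_betw_def inj_on_def image_iff Suc_le_eq gr0_conv_Suc)
  moreover have "finite {a. a * k = n}" for n
    by (rule finite_subset[of _ "{..n}"]) (use assms in auto)
  then have "weight_fps (\<lambda>(_, a). k + a * k) ({()} \<times> UNIV) = weight_fps (\<lambda>_::unit. k) {()} * weight_fps (\<lambda>a. a * k) UNIV"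
    by (intro weight_fps_times) auto
  moreover have "weight_fps (\<lambda>_::unit. k) {()} = fps_X ^ k"
    by (rule fps_ext) (auto simp: weight_fps_def)
  ultimately show ?thesis using weight_fps_multiples[OF assms] by simp
qed

lemma weight_fps_bool: "k > 0 \<Longrightarrow> weight_fps (\<lambda>b. if b then k else 0) UNIV = 1 + fps_X ^ k"
proof (rule fps_ext)
  fix n assume "k > 0"
  have "{b. (if b then k else 0) = n} = (if n = 0 then {False} else if n = k then {True} else {})"
    using \<open>k > 0\<close> by auto
  then show "fps_nth (weight_fps (\<lambda>b. if b then k else 0) UNIV) n = fps_nth (1 + fps_X ^ k) n"
    using \<open>k > 0\<close> by (auto simp: weight_fps_def)
qed

section \<open>Overpartitions built up by their largest part\<close>

abbreviation weight :: "(nat \<times> bool) list \<Rightarrow> nat" where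
  "weight xs \<equiv> sum_list (map fst xs)"

text \<open>With a pairwise relation in place of the index condition on overlines,
  \<open>sorted_wrt_append\<close> applies when blocks are attached or removed.\<close>

lemma is_overpartition_iff:
  "is_overpartition n xs \<longleftrightarrow>
     sorted_wrt (\<lambda>p q. fst p \<ge> fst q \<and> (snd q \<longrightarrow> fst p \<noteq> fst q)) xs \<and>
     (\<forall>x \<in> set xs. fst x > 0) \<and> weight xs = n"
  unfolding is_overpartition_def sorted_wrt_map sorted_wrt_iff_nth_less
  by (auto dest: less_trans)

definition bounded_overpartitions :: "nat \<Rightarrow> nat \<Rightarrow> (nat \<times> bool) list set" where
  "bounded_overpartitions m N = {xs. is_overpartition (weight xs) xs \<and> (\<forall>x \<in> set xs. fst x \<le> N) \<and>
     (\<forall>j \<in> {1..min m N}. (j, False) \<in> set xs)}"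

text \<open>The occurrences of the largest admissible part: possibly one overlined copy, which must
  come first, and then \<open>a\<close> copies that are not overlined.\<close>

definition attach_block :: "nat \<Rightarrow> bool \<times> nat \<times> (nat \<times> bool) list \<Rightarrow> (nat \<times> bool) list" where
  "attach_block k = (\<lambda>(b, a, ys). (if b then [(k, True)] else []) @ replicate a (k, False) @ ys)"

text \<open>All copies of the largest size form an initial block in which only the first may be
  overlined, so a flag, a multiplicity and the remainder determine the list. The constraint on
  \<open>a\<close> carries the demand for a non-overlined \<open>Suc N\<close>.\<close>

lemma bij_betw_attach_block:
  "bij_betw (attach_block (Suc N))
     (UNIV \<times> {a. Suc N \<le> m \<longrightarrow> a \<ge> 1} \<times> bounded_overpartitions m N)
     (bounded_overpartitions m (Suc N))"
  (is "bij_betw ?f ?D ?R")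
proof (rule bij_betw_imageI)
  show "inj_on ?f ?D"
  proof (rule inj_on_inverseI)
    fix z assume "z \<in> ?D"
    then obtain b a ys where z: "z = (b, a, ys)" and ys: "\<forall>x\<in>set ys. fst x \<le> N"
      by (auto simp: bounded_overpartitions_def)
    have "filter (\<lambda>x. fst x = Suc N \<and> \<not> snd x) ys = []" "filter (\<lambda>x. fst x \<noteq> Suc N) ys = ys"
      using ys by (auto simp: filter_empty_conv filter_id_conv)
    then show "((Suc N, True) \<in> set (?f z), length (filter (\<lambda>x. fst x = Suc N \<and> \<not> snd x) (?f z)),
        filter (\<lambda>x. fst x \<noteq> Suc N) (?f z)) = z"
      using ys by (force simp: z attach_block_def)
  qed
  show "?f ` ?D = ?R"
  proof (intro equalityI subsetI)
    fix xs assume "xs \<in> ?f ` ?D"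
    then obtain b a ys where xs: "xs = ?f (b, a, ys)" and a: "Suc N \<le> m \<longrightarrow> a \<ge> 1"
      and ys: "ys \<in> bounded_overpartitions m N" by auto
    have "(j, False) \<in> set xs" if "j \<in> {1..min m (Suc N)}" for j
      using that ys a unfolding xs bounded_overpartitions_def attach_block_def
      by (cases "j = Suc N") auto
    moreover have "sorted_wrt (\<lambda>p q. fst q \<le> fst p \<and> (snd q \<longrightarrow> fst p \<noteq> fst q)) (replicate a (Suc N, False))"
      by (simp add: sorted_wrt_iff_nth_less)
    ultimately show "xs \<in> ?R" using ys
      unfolding xs bounded_overpartitions_def attach_block_def
      by (force simp: is_overpartition_iff sorted_wrt_append)
  next
    fix xs assume "xs \<in> ?R"
    then have srt: "sorted_wrt (\<lambda>p q. fst q \<le> fst p \<and> (snd q \<longrightarrow> fst p \<noteq> fst q)) xs"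
      and pos: "\<forall>x\<in>set xs. fst x > 0" and le: "\<forall>x\<in>set xs. fst x \<le> Suc N"
      and mem: "\<forall>j \<in> {1..min m (Suc N)}. (j, False) \<in> set xs"
      by (auto simp: bounded_overpartitions_def is_overpartition_iff)
    define us where "us = takeWhile (\<lambda>x. fst x = Suc N) xs"
    define ys where "ys = dropWhile (\<lambda>x. fst x = Suc N) xs"
    have xs: "xs = us @ ys" by (simp add: us_def ys_def)
    have us: "\<forall>x\<in>set us. fst x = Suc N"
      unfolding us_def by (auto dest: set_takeWhileD)
    have ys: "\<forall>x\<in>set ys. fst x \<le> N"
    proof (cases ys)
      case (Cons z zs)
      have "fst z \<noteq> Suc N"
        using Cons hd_dropWhile[of "\<lambda>x. fst x = Suc N" xs] by (simp add: ys_def)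
      moreover have "z \<in> set xs" using xs Cons by simp
      ultimately have "fst z \<le> N" using le by fastforce
      then show ?thesis using srt unfolding xs Cons by (auto simp: sorted_wrt_append)
    qed simp
    obtain b a where ba: "us = (if b then [(Suc N, True)] else []) @ replicate a (Suc N, False)"
    proof (cases us)
      case Nil
      then show ?thesis using that[of False 0] by simp
    next
      case (Cons p vs)
      \<comment> \<open>An entry preceded by one of the same size cannot be overlined, so only the
        first entry of the block can be.\<close>
      have "vs = replicate (length vs) (Suc N, False)"
      proof (rule replicate_eqI)
        fix q assume "q \<in> set vs"
        then have "fst q = Suc N" "snd q \<longrightarrow> fst p \<noteq> fst q" "fst p = Suc N"
          using srt us unfolding xs Cons by auto
        then show "q = (Suc N, False)" by (cases q) auto
      qed simp
      then obtain a where vs: "vs = replicate a (Suc N, False)" by blast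
      have "p = (Suc N, True) \<or> p = (Suc N, False)" using us Cons by (cases p) auto
      then show ?thesis using that[of True a] that[of False "Suc a"] by (auto simp: Cons vs)
    qed
    have "a \<ge> 1" if "Suc N \<le> m"
    proof -
      have "(Suc N, False) \<in> set us" using mem that ys unfolding xs by force
      then show ?thesis unfolding ba by (auto split: if_splits)
    qed
    moreover have "ys \<in> bounded_overpartitions m N"
      unfolding bounded_overpartitions_def is_overpartition_iff
    proof (intro CollectI conjI ballI)
      fix j assume "j \<in> {1..min m N}"
      then have "(j, False) \<in> set xs" "(j, False) \<notin> set us" using mem us by auto
      then show "(j, False) \<in> set ys" by (simp add: xs)
    qed (use srt pos ys in \<open>auto simp: xs sorted_wrt_append\<close>)
    moreover have "xs = ?f (b, a, ys)" by (simp add: attach_block_def xs ba)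
    ultimately show "xs \<in> ?f ` ?D" by blast
  qed
qed

lemma finite_bounded_overpartitions: "finite {xs \<in> bounded_overpartitions m N. weight xs = n}"
  by (rule finite_subset[OF _ finite_overpartitions[of n]])
    (auto simp: bounded_overpartitions_def overpartitions_def)

text \<open>Size \<open>k\<close> contributes \<open>1 + fps_X ^ k\<close> for the optional
  overlined copy and a geometric series for the others, shifted by \<open>fps_X ^ k\<close> if a
  non-overlined copy is compulsory.\<close>

lemma weight_fps_bounded_overpartitions:
  "weight_fps weight (bounded_overpartitions m N) =
     (\<Prod>k=1..N. (1 + fps_X ^ k) * ((if k \<le> m then fps_X ^ k else 1) * inverse (1 - fps_X ^ k)))"
proof (induction N)
  case 0
  have "xs = []" if "xs \<in> bounded_overpartitions m 0" for xs
    using that by (cases xs) (auto simp: bounded_overpartitions_def is_overpartition_iff)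
  moreover have "[] \<in> bounded_overpartitions m 0"
    by (auto simp: bounded_overpartitions_def is_overpartition_iff)
  ultimately have "bounded_overpartitions m 0 = {[]}" by blast
  moreover have "{xs \<in> {[]}. weight xs = n} = (if n = 0 then {[]} else {})" for n
    by auto
  ultimately show ?case by (intro fps_ext) (simp add: weight_fps_def)
next
  case (Suc N)
  define A where "A = {a::nat. Suc N \<le> m \<longrightarrow> a \<ge> 1}"
  have fin: "finite {a \<in> A. a * Suc N = n}" for n
    by (rule finite_subset[of _ "{..n}"]) auto
  define wt where "wt = (\<lambda>z. case z of (a, ys) \<Rightarrow> a * Suc N + weight ys)"
  have fin': "finite {z \<in> A \<times> bounded_overpartitions m N. wt z = n}" for n
  proof (rule finite_subset)
    show "{z \<in> A \<times> bounded_overpartitions m N. wt z = n}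
        \<subseteq> {..n} \<times> (\<Union>i\<in>{..n}. {xs \<in> bounded_overpartitions m N. weight xs = i})"
      by (auto simp: wt_def)
    show "finite ({..n} \<times> (\<Union>i\<in>{..n}. {xs \<in> bounded_overpartitions m N. weight xs = i}))"
      using finite_bounded_overpartitions by auto
  qed
  have "weight_fps weight (bounded_overpartitions m (Suc N))
      = weight_fps (\<lambda>(b, z). (if b then Suc N else 0) + wt z) (UNIV \<times> A \<times> bounded_overpartitions m N)"
    by (rule weight_fps_bij_betw[symmetric], unfold A_def, rule bij_betw_attach_block)
      (auto simp: attach_block_def sum_list_replicate wt_def)
  also have "\<dots> = weight_fps (\<lambda>b. if b then Suc N else 0) UNIV * weight_fps wt (A \<times> bounded_overpartitions m N)"
    by (rule weight_fps_times) (use fin' in auto)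
  also have "weight_fps wt (A \<times> bounded_overpartitions m N) = 
      weight_fps (\<lambda>a. a * Suc N) A * weight_fps weight (bounded_overpartitions m N)"
    unfolding wt_def by (rule weight_fps_times) (use fin finite_bounded_overpartitions in auto)
  also have "weight_fps (\<lambda>a. a * Suc N) A = (if Suc N \<le> m then fps_X ^ Suc N else 1) * inverse (1 - fps_X ^ Suc N)"
    using weight_fps_multiples[of "Suc N"] weight_fps_positive_multiples[of "Suc N"] by (simp add: A_def)
  finally show ?case
    using weight_fps_bool[of "Suc N"] by (simp add: Suc.IH mult_ac)
qed

section \<open>The mex as a tail sum\<close>

lemma less_overline_mex_iff: "m < overline_mex xs \<longleftrightarrow> (\<forall>j\<in>{1..m}. (j, False) \<in> set xs)"
proof
  assume "m < overline_mex xs"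
  then have "j < (LEAST m. m > 0 \<and> (m, False) \<notin> set xs)" if "j \<le> m" for j
    using that by (simp add: overline_mex_def)
  from not_less_Least[OF this] show "\<forall>j\<in>{1..m}. (j, False) \<in> set xs"
    by fastforce
next
  assume *: "\<forall>j\<in>{1..m}. (j, False) \<in> set xs"
  have "overline_mex xs > 0 \<and> (overline_mex xs, False) \<notin> set xs"
    unfolding overline_mex_def by (rule LeastI_ex) (use overline_mex_exists[of False xs] in auto)
  with * show "m < overline_mex xs"
    by (metis One_nat_def Suc_leI atLeastAtMost_iff not_less)
qed

lemma overpartition_part_le: "xs \<in> overpartitions n \<Longrightarrow> x \<in> set xs \<Longrightarrow> fst x \<le> n"
  using member_le_sum_list[of "fst x" "map fst xs"] by (auto simp: overpartitions_def is_overpartition_def)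

lemma overline_mex_le:
  assumes "xs \<in> overpartitions n"
  shows "overline_mex xs \<le> Suc n"
proof -
  have "(Suc n, False) \<notin> set xs" using overpartition_part_le[OF assms] by force
  then show ?thesis unfolding overline_mex_def by (intro Least_le) auto
qed

text \<open>A mex is the number of naturals \<open>m\<close> below it, so exchanging sums counts the
  overpartitions with non-overlined parts 1 to \<open>m\<close>. Parts are at most \<open>n\<close>
  and the mex at most \<open>n + 1\<close>, so cutting both ranges off at \<open>N > n\<close>
  leaves the coefficient unchanged; the compulsory copies give the triangular power of
  \<open>fps_X\<close>.\<close>

lemma sigma_overline_mex_fps:
  assumes "n < N"
  shows "(of_nat (sigma_overline_mex n) :: complex) =
    fps_nth (\<Sum>m<N. fps_X ^ (\<Sum>{1..m}) * (\<Prod>k=1..N. (1 + fps_X ^ k) * inverse (1 - fps_X ^ k))) n"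
proof -
  have "sigma_overline_mex n = (\<Sum>xs\<in>overpartitions n. \<Sum>m<N. of_bool (m < overline_mex xs))"
    unfolding sigma_overline_mex_def
  proof (rule sum.cong)
    fix xs assume "xs \<in> overpartitions n"
    then have "overline_mex xs \<le> N" using overline_mex_le[of xs n] assms by simp
    then have "{..<N} \<inter> {m. m < overline_mex xs} = {..<overline_mex xs}" by auto
    then show "overline_mex xs = (\<Sum>m<N. of_bool (m < overline_mex xs))"
      by (simp add: of_bool_def sum.If_cases)
  qed simp
  also have "\<dots> = (\<Sum>m<N. card {xs \<in> overpartitions n. m < overline_mex xs})"
    by (subst sum.swap) (simp add: of_bool_def sum.If_cases finite_overpartitions Collect_conj_eq)
  also have "of_nat \<dots> = (\<Sum>m<N. fps_nth (weight_fps weight (bounded_overpartitions m N)) n)"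
    unfolding of_nat_sum
  proof (rule sum.cong)
    fix m assume "m \<in> {..<N}"
    then have "min m N = m" by simp
    moreover have "\<forall>x\<in>set xs. fst x \<le> N" if "xs \<in> overpartitions n" for xs
      using overpartition_part_le[OF that] assms by fastforce
    ultimately have "{xs \<in> overpartitions n. m < overline_mex xs}
        = {xs \<in> bounded_overpartitions m N. weight xs = n}"
      unfolding less_overline_mex_iff bounded_overpartitions_def overpartitions_def
      by (auto simp: is_overpartition_iff)
    then show "of_nat (card {xs \<in> overpartitions n. m < overline_mex xs})
        = fps_nth (weight_fps weight (bounded_overpartitions m N)) n"
      by (simp add: weight_fps_def)
  qed simp
  also have "\<dots> = (\<Sum>m<N. fps_nth (fps_X ^ (\<Sum>{1..m}) *
      (\<Prod>k=1..N. (1 + fps_X ^ k) * inverse (1 - fps_X ^ k))) n)"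
  proof (intro sum.cong refl arg_cong2[where f = fps_nth])
    fix m assume "m \<in> {..<N}"
    then have "{1..N} \<inter> {k. k \<le> m} = {1..m}" by auto
    then have "(\<Prod>k=1..N. if k \<le> m then fps_X ^ k else 1) = (fps_X ^ (\<Sum>{1..m}) :: complex fps)"
      by (simp add: prod.If_cases power_sum)
    then show "weight_fps weight (bounded_overpartitions m N) =
        fps_X ^ (\<Sum>{1..m}) * (\<Prod>k=1..N. (1 + fps_X ^ k) * inverse (1 - fps_X ^ k))"
      unfolding weight_fps_bounded_overpartitions prod.distrib by (simp add: mult_ac)
  qed
  finally show ?thesis unfolding fps_sum_nth by simp
qed

section \<open>Gauss' identity modulo powers of X, and the cube of the product\<close>

text \<open>Here \<open>v k\<close> plays the role of \<open>1 / (1 - q\<^bsup>2k-1\<^esup>)\<close>, so that the identity makes sense in any commutative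
  ring. In the induction step, the difference of corresponding summands on the right-hand side
  is a multiple of \<open>B (s + 1) - B s\<close> and telescopes.\<close>

lemma shanks_identity:
  fixes q :: "'a :: comm_ring_1" and v :: "nat \<Rightarrow> 'a"
  assumes v: "\<And>k. k \<ge> 1 \<Longrightarrow> (1 - q ^ (2 * k - 1)) * v k = 1"
  shows "(\<Sum>m<2*n. q ^ (\<Sum>{1..m})) =
    (\<Sum>s<n. (\<Prod>k=s+1..n. (1 - q ^ (2 * k)) * v k) * q ^ (s * (2 * n + 1)))"
proof (induction n)
  case (Suc n)
  define R where "R s = (\<Prod>k=s+1..n. (1 - q ^ (2 * k)) * v k)" for s
  define w where "w = v (Suc n)"
  define B where "B s = q ^ (s * (2 * n + 1)) * (1 - q ^ (2 * s)) * R s" for s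
  have w: "(1 - q ^ (2 * n + 1)) * w = 1"
    using v[of "Suc n"] by (simp add: w_def)
  \<comment> \<open>The factor \<open>1 - q ^ (2 * s + 1)\<close> cancels \<open>v (Suc s)\<close>,
    which occurs in \<open>R s\<close> but not in \<open>R (Suc s)\<close>.\<close>
  have R_step: "(1 - q ^ (2 * s + 1)) * R s = (1 - q ^ (2 * s + 2)) * R (Suc s)" if "s < n" for s
  proof -
    have "R s = ((1 - q ^ (2 * s + 2)) * v (Suc s)) * R (Suc s)"
      unfolding R_def using that by (subst prod.atLeast_Suc_atMost) auto
    moreover have "(1 - q ^ (2 * s + 1)) * v (Suc s) = 1"
      using v[of "Suc s"] by simp
    ultimately show ?thesis by (metis (no_types, lifting) mult.assoc mult.commute mult.left_neutral)
  qed
  have R_Suc: "(\<Prod>k=s+1..Suc n. (1 - q ^ (2 * k)) * v k) = R s * (1 - q ^ (2 * n + 2)) * w" if "s \<le> n" for s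
    using that by (simp add: R_def w_def prod.nat_ivl_Suc' mult_ac)
  have diff: "R s * (1 - q ^ (2 * n + 2)) * w * q ^ (s * (2 * n + 3)) - R s * q ^ (s * (2 * n + 1))
      = w * (B (Suc s) - B s)" if "s < n" for s
  proof -
    \<comment> \<open>Used with \<open>V = q ^ (s * (2 * n + 1))\<close>, \<open>U = q ^ s\<close>
      and \<open>Y = q ^ (2 * n + 1)\<close>; the last term then vanishes because
      \<open>(1 - Y) * w = 1\<close>.\<close>
    have key: "R * (1 - Y * q) * w * (V * U\<^sup>2) - R * V
        = w * (V * Y * ((1 - U\<^sup>2 * q) * R) - V * (1 - U\<^sup>2) * R) + ((1 - Y) * w - 1) * (R * V)"
      for R V U Y :: 'a
      by (simp add: algebra_simps power2_eq_square)
    have "B (Suc s) = q ^ (s * (2 * n + 1)) * q ^ (2 * n + 1) * ((1 - (q ^ s)\<^sup>2 * q) * R s)"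
      using R_step[OF that] by (simp add: B_def mult_ac power_add flip: power_mult)
    moreover have "B s = q ^ (s * (2 * n + 1)) * (1 - (q ^ s)\<^sup>2) * R s"
      by (simp add: B_def mult_ac flip: power_mult)
    moreover have "q ^ (s * (2 * n + 3)) = q ^ (s * (2 * n + 1)) * (q ^ s)\<^sup>2"
      by (simp add: algebra_simps flip: power_mult power_add)
    moreover have "q ^ (2 * n + 2) = q ^ (2 * n + 1) * q" by simp
    ultimately show ?thesis by (simp only: key w diff_self mult_zero_left add_0_right)
  qed
  have "(\<Sum>s<n. R s * (1 - q ^ (2 * n + 2)) * w * q ^ (s * (2 * n + 3)) - R s * q ^ (s * (2 * n + 1)))
      = w * (B n - B 0)"
    using diff by (simp add: sum_distrib_left[symmetric] sum_lessThan_telescope)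
  then have sum: "(\<Sum>s<n. R s * (1 - q ^ (2 * n + 2)) * w * q ^ (s * (2 * n + 3)))
      = (\<Sum>s<n. R s * q ^ (s * (2 * n + 1))) + w * (q ^ (n * (2 * n + 1)) * (1 - q ^ (2 * n)))"
    unfolding sum_subtractf by (simp add: diff_eq_eq add.commute B_def R_def)
  have tri: "\<Sum>{1..m} = m * (m + 1) div 2" for m :: nat
    by (induction m) auto
  have tri1: "\<Sum>{1..2 * n} = n * (2 * n + 1)" and tri2: "\<Sum>{1..Suc (2 * n)} = n * (2 * n + 1) + (2 * n + 1)"
    unfolding tri by (simp_all add: algebra_simps)
  have "(\<Sum>s<Suc n. (\<Prod>k=s+1..Suc n. (1 - q ^ (2 * k)) * v k) * q ^ (s * (2 * Suc n + 1)))
      = (\<Sum>s<Suc n. R s * (1 - q ^ (2 * n + 2)) * w * q ^ (s * (2 * n + 3)))"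
  proof (rule sum.cong)
    fix s assume "s \<in> {..<Suc n}"
    moreover have "2 * Suc n + 1 = 2 * n + 3" by simp
    ultimately show "(\<Prod>k=s+1..Suc n. (1 - q ^ (2 * k)) * v k) * q ^ (s * (2 * Suc n + 1)) =
        R s * (1 - q ^ (2 * n + 2)) * w * q ^ (s * (2 * n + 3))"
      by (simp only: R_Suc lessThan_iff less_Suc_eq_le)
  qed simp
  also have "\<dots> = (\<Sum>s<n. R s * q ^ (s * (2 * n + 1))) + w * (q ^ (n * (2 * n + 1)) * (1 - q ^ (2 * n)))
      + (1 - q ^ (2 * n + 2)) * w * q ^ (n * (2 * n + 3))"
    using sum by (simp add: R_def)
  also have "\<dots> = (\<Sum>s<n. R s * q ^ (s * (2 * n + 1))) +
      (w * (q ^ (n * (2 * n + 1)) * (1 - q ^ (2 * n))) + (1 - q ^ (2 * n + 2)) * w * q ^ (n * (2 * n + 3)))"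
    by (simp only: add.assoc)
  \<comment> \<open>The telescoped boundary term and the new summand \<open>s = n\<close> combine to
    a multiple of \<open>1 - q ^ (4 * n + 2)\<close>, a difference of squares: \<open>w\<close>
    cancels one factor, and the other gives the two new triangular powers.\<close>
  also have "w * (q ^ (n * (2 * n + 1)) * (1 - q ^ (2 * n))) + (1 - q ^ (2 * n + 2)) * w * q ^ (n * (2 * n + 3))
      = ((1 - q ^ (2 * n + 1)) * w) * (q ^ (n * (2 * n + 1)) * (1 + q ^ (2 * n + 1)))"
  proof -
    have "q ^ (2 * n + 2) = q ^ (2 * n) * (q * q)" "q ^ (2 * n + 1) = q ^ (2 * n) * q"
      "q ^ (n * (2 * n + 3)) = q ^ (n * (2 * n + 1)) * q ^ (2 * n)"
      by (simp_all add: algebra_simps flip: power_add)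
    then show ?thesis by (simp only: ring_distribs mult_ac) simp
  qed
  also have "\<dots> = q ^ \<Sum>{1..2 * n} + q ^ \<Sum>{1..Suc (2 * n)}"
    unfolding w tri1 tri2 by (simp only: power_add[of q "n * (2 * n + 1)" "2 * n + 1"]
        distrib_left[of "q ^ (n * (2 * n + 1))"] mult_1_left mult_1_right)
  finally have "(\<Sum>s<Suc n. (\<Prod>k=s+1..Suc n. (1 - q ^ (2 * k)) * v k) * q ^ (s * (2 * Suc n + 1)))
      = (\<Sum>m<2*n. q ^ (\<Sum>{1..m})) + q ^ \<Sum>{1..2 * n} + q ^ \<Sum>{1..Suc (2 * n)}"
    using Suc.IH by (simp add: R_def add.assoc)
  then show ?case by simp
qed simp

lemma prod_pairs:
  fixes f :: "nat \<Rightarrow> 'a :: comm_monoid_mult"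
  shows "(\<Prod>k=1..2*n. f k) = (\<Prod>k=1..n. f (2 * k - 1) * f (2 * k))"
  by (induction n) (simp_all add: mult_ac)

text \<open>Congruence to 1 modulo \<open>d\<close> is multiplicative. With \<open>d\<close> a power
  of \<open>fps_X\<close> it means agreement of low coefficients, which replaces the convergence of
  infinite products.\<close>

lemma dvd_prod_diff_one:
  fixes d :: "'a :: comm_ring_1"
  assumes "\<And>k. k \<in> A \<Longrightarrow> d dvd f k - 1"
  shows "d dvd prod f A - 1"
  using assms
proof (induction A rule: infinite_finite_induct)
  case (insert x A)
  have "prod f (insert x A) - 1 = (f x - 1) * prod f A + (prod f A - 1)"
    using insert.hyps by (simp add: algebra_simps)
  then show ?case using insert by (metis dvd_add dvd_mult2 insertI1 insertI2)
qed auto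

lemma fps_nth_eq_if_dvd_diff:
  fixes f g :: "'a :: comm_ring_1 fps"
  assumes "fps_X ^ d dvd f - g" "n < d"
  shows "fps_nth f n = fps_nth g n"
proof -
  obtain h where "f = g + fps_X ^ d * h"
    using assms(1) by (metis add.commute diff_add_cancel dvd_def)
  then show ?thesis using assms(2) by (simp add: fps_X_power_mult_nth)
qed

text \<open>Modulo \<open>fps_X ^ (L + 1)\<close> only \<open>s = 0\<close> survives in Shanks'
  identity and gives Gauss' product; splitting \<open>a (2 * k)\<close> as \<open>a k * b k\<close>
  turns its product with the overpartition series into a cube. The outcome is a polynomial, so its
  coefficients are circle integrals of finite sums.\<close>

lemma sigma_overline_mex_eq_coeff:
  assumes "n \<le> L"
  shows "(of_nat (sigma_overline_mex n) :: complex) = coeff ((\<Prod>k=1..L. 1 + monom 1 k) ^ 3) n"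
proof -
  define a b i :: "nat \<Rightarrow> complex fps"
    where "a k = 1 - fps_X ^ k" and "b k = 1 + fps_X ^ k" and "i k = inverse (1 - fps_X ^ k)" for k
  have ai: "a k * i k = 1" if "k \<ge> 1" for k
    using inverse_one_minus_fps_X_power[of k] that by (simp add: a_def i_def)
  \<comment> \<open>The coefficient of index \<open>n\<close>, at most \<open>L\<close>, must lie
    strictly below the exponent of the modulus.\<close>
  define L' where "L' = Suc L"
  define C where "C = (\<Prod>k=1..2*L'. b k * i k)"
  define T where "T = (\<Prod>k=L'+1..2*L'. i k ^ 2 * b k)"
  have "(\<Sum>m<2*L'. fps_X ^ (\<Sum>{1..m})) =
      (\<Sum>s<L'. (\<Prod>k=s+1..L'. (1 - fps_X ^ (2 * k)) * i (2 * k - 1)) * fps_X ^ (s * (2 * L' + 1)))"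
    by (rule shanks_identity) (use ai in \<open>simp add: a_def\<close>)
  also have "\<dots> = (\<Prod>k=1..L'. a (2 * k) * i (2 * k - 1)) +
      (\<Sum>s=1..<L'. (\<Prod>k=s+1..L'. (1 - fps_X ^ (2 * k)) * i (2 * k - 1)) * fps_X ^ (s * (2 * L' + 1)))"
    by (simp add: L'_def lessThan_atLeast0 sum.atLeast_Suc_lessThan a_def)
  finally have "fps_X ^ L' dvd (\<Sum>m<2*L'. fps_X ^ (\<Sum>{1..m})) - (\<Prod>k=1..L'. a (2 * k) * i (2 * k - 1))"
    using mult_le_mono[of 1 _ L' "2 * L' + 1"]
    by (simp, intro dvd_sum dvd_mult le_imp_power_dvd) (fastforce simp: Suc_le_eq)
  then have 1: "fps_X ^ L' dvd (\<Sum>m<2*L'. fps_X ^ (\<Sum>{1..m})) * C - (\<Prod>k=1..L'. a (2 * k) * i (2 * k - 1)) * C"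
    unfolding left_diff_distrib[symmetric] by (rule dvd_mult2)
  have "(\<Prod>k=1..L'. a (2 * k) * i (2 * k - 1)) = (\<Prod>k=1..L'. (a k * b k)\<^sup>2 * (i (2 * k - 1) * i (2 * k)))"
  proof (rule prod.cong)
    fix k assume "k \<in> {1..L'}"
    \<comment> \<open>Multiplying by \<open>a (2 * k) * i (2 * k) = 1\<close> squares the numerator
      and completes the odd inverses to all indices up to \<open>2 * L'\<close>.\<close>
    then have "a (2 * k) * i (2 * k - 1) = a (2 * k) * i (2 * k - 1) * (a (2 * k) * i (2 * k))"
      using ai[of "2 * k"] by simp
    moreover have "1 - z * z = (1 - z) * (1 + z)" for z :: "complex fps"
      by (simp add: algebra_simps)
    then have "a (2 * k) = a k * b k"
      by (simp only: a_def b_def mult_2 power_add)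
    ultimately show "a (2 * k) * i (2 * k - 1) = (a k * b k)\<^sup>2 * (i (2 * k - 1) * i (2 * k))"
      by (simp only: power2_eq_square mult_ac)
  qed simp
  also have "\<dots> = (\<Prod>k=1..L'. (a k * b k)\<^sup>2) * (\<Prod>k=1..2*L'. i k)"
    by (simp only: prod.distrib prod_pairs)
  finally have "(\<Prod>k=1..L'. a (2 * k) * i (2 * k - 1)) * C
      = (\<Prod>k=1..L'. (a k * b k)\<^sup>2) * (\<Prod>k=1..2*L'. i k ^ 2 * b k)"
    by (simp add: C_def prod.distrib power2_eq_square mult_ac)
  also have "{1..2*L'} = {1..L'} \<union> {L'+1..2*L'}" by auto
  also have "(\<Prod>k\<in>\<dots>. i k ^ 2 * b k) = (\<Prod>k=1..L'. i k ^ 2 * b k) * T"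
    unfolding T_def by (rule prod.union_disjoint) auto
  also have "(\<Prod>k=1..L'. (a k * b k)\<^sup>2) * ((\<Prod>k=1..L'. i k ^ 2 * b k) * T)
      = (\<Prod>k=1..L'. (a k * i k)\<^sup>2 * b k ^ 3) * T"
    by (simp add: prod.distrib power_mult_distrib power3_eq_cube power2_eq_square mult_ac)
  also have "(\<Prod>k=1..L'. (a k * i k)\<^sup>2 * b k ^ 3) = (\<Prod>k=1..L'. b k ^ 3)"
    by (intro prod.cong) (simp_all add: ai)
  finally have 2: "(\<Prod>k=1..L'. a (2 * k) * i (2 * k - 1)) * C - (\<Prod>k=1..L'. b k ^ 3)
      = (\<Prod>k=1..L'. b k ^ 3) * (T - 1)"
    by (simp add: algebra_simps)
  have "fps_X ^ L' dvd T - 1" unfolding T_def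
  proof (rule dvd_prod_diff_one)
    fix k assume k: "k \<in> {L'+1..2*L'}"
    then have "i k = 1 + fps_X ^ k * i k"
      using ai[of k] by (simp add: a_def algebra_simps)
    then have "i k - 1 = fps_X ^ k * i k" by (metis add_diff_cancel_left')
    moreover have "i k ^ 2 * b k - 1 = fps_X ^ k * i k ^ 2 + (i k - 1) * (i k + 1)"
      by (simp add: b_def power2_eq_square algebra_simps)
    ultimately have "i k ^ 2 * b k - 1 = fps_X ^ k * (i k ^ 2 + i k * (i k + 1))"
      by (simp only: distrib_left mult.assoc)
    moreover have "fps_X ^ L' dvd (fps_X ^ k :: complex fps)"
      using k by (intro le_imp_power_dvd) auto
    ultimately show "fps_X ^ L' dvd i k ^ 2 * b k - 1"
      by simp
  qed
  then have 3: "fps_X ^ L' dvd (\<Sum>m<2*L'. fps_X ^ (\<Sum>{1..m})) * C - (\<Prod>k=1..L'. b k ^ 3)"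
    using dvd_add[OF 1 dvd_mult, of "T - 1" "\<Prod>k=1..L'. b k ^ 3"] unfolding 2[symmetric] by simp
  have "(\<Prod>k=1..L'. b k ^ 3) - (\<Prod>k=1..L. b k ^ 3) = (\<Prod>k=1..L. b k ^ 3) * fps_X ^ L' * (3 + 3 * fps_X ^ L' + (fps_X ^ L') ^ 2)"
    unfolding L'_def b_def by (simp add: algebra_simps power3_eq_cube power2_eq_square)
  then have "fps_X ^ L' dvd (\<Prod>k=1..L'. b k ^ 3) - (\<Prod>k=1..L. b k ^ 3)"
    by simp
  from dvd_add[OF 3 this] have "fps_X ^ L' dvd (\<Sum>m<2*L'. fps_X ^ (\<Sum>{1..m})) * C - (\<Prod>k=1..L. b k ^ 3)"
    by simp
  then have "fps_nth ((\<Sum>m<2*L'. fps_X ^ (\<Sum>{1..m})) * C) n = fps_nth (\<Prod>k=1..L. b k ^ 3) n"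
    by (rule fps_nth_eq_if_dvd_diff) (use assms in \<open>simp add: L'_def\<close>)
  moreover have "of_nat (sigma_overline_mex n) = fps_nth ((\<Sum>m<2*L'. fps_X ^ (\<Sum>{1..m})) * C) n"
  proof -
    have "n < 2 * L'" using assms by (simp add: L'_def)
    from sigma_overline_mex_fps[OF this] show ?thesis
      by (simp only: sum_distrib_right C_def b_def i_def)
  qed
  moreover have "(\<Prod>k=1..L. b k ^ 3) = fps_of_poly ((\<Prod>k=1..L. 1 + monom 1 k) ^ 3)"
    by (simp add: b_def prod_power_distrib fps_of_poly_power fps_of_poly_prod fps_of_poly_add fps_of_poly_monom')
  ultimately show ?thesis by simp
qed

section \<open>Expansion of the logarithm of the product\<close>

text \<open>The function \<open>alt_dilog (exp (- z))\<close> is an antiderivative of \<open>- ln (1 + exp (- z))\<close>: it replaces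
  the contour integral in the trapezoidal rule.\<close>

definition alt_dilog :: "complex \<Rightarrow> complex" where
  "alt_dilog w = (\<Sum>n. - ((-1) ^ n) / of_nat n ^ 2 * w ^ n)"

lemma summable_inverse_squares: "summable (\<lambda>n. 1 / real n ^ 2)"
  using inverse_power_summable[of 2, where 'a = real] by (simp add: field_simps)

lemma alt_dilog_term_bound: "cmod w \<le> 1 \<Longrightarrow> cmod (- ((-1) ^ n) / of_nat n ^ 2 * w ^ n) \<le> cmod w * (1 / real n ^ 2)"
  \<comment> \<open>For \<open>n = 0\<close> both sides are 0, by division by zero; for positive
    \<open>n\<close> one factor \<open>cmod w\<close> is kept.\<close>
  by (cases n) 
    (auto simp: norm_mult norm_divide norm_power divide_right_mono mult_left_le power_le_one
      simp del: of_nat_Suc)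

lemma suminf_inverse_squares: "(\<Sum>n. 1 / real n ^ 2) = pi\<^sup>2 / 6"
  using inverse_squares_sums summable_inverse_squares
  by (subst suminf_split_initial_segment[of _ 1]) (auto simp: sums_iff add.commute)

lemma norm_alt_dilog_le:
  assumes "cmod w \<le> 1"
  shows "cmod (alt_dilog w) \<le> 3 * cmod w"
proof -
  have "cmod (alt_dilog w) \<le> (\<Sum>n. cmod w * (1 / real n ^ 2))"
    unfolding alt_dilog_def using summable_inverse_squares alt_dilog_term_bound[OF assms]
    by (intro norm_suminf_le summable_mult) auto
  also have "\<dots> = cmod w * (pi\<^sup>2 / 6)"
    using suminf_mult[OF summable_inverse_squares, of "cmod w"] by (simp only: suminf_inverse_squares)
  \<comment> \<open>As \<open>pi < 4\<close>, the value is at most 16/6, hence below 3.\<close>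
  also have "\<dots> \<le> cmod w * 3"
    using power_mono[of pi 4 2] pi_less_4 by (intro mult_left_mono) simp_all
  finally show ?thesis by (simp add: mult.commute)
qed

text \<open>The closed disc is taken because the first trapezoid starts at the boundary point
  \<open>exp 0 = 1\<close>; the series is still dominated there by the inverse squares.\<close>

lemma continuous_on_alt_dilog: "continuous_on (cball 0 1) alt_dilog"
proof -
  define c :: "nat \<Rightarrow> complex" where "c n = - ((-1) ^ n) / of_nat n ^ 2" for n
  have "uniform_limit (cball 0 1) (\<lambda>n w. \<Sum>i<n. c i * w ^ i) (\<lambda>w. \<Sum>i. c i * w ^ i) sequentially"
  proof (rule Weierstrass_m_test)
    fix n and w :: complex assume "w \<in> cball 0 1"
    then show "cmod (c n * w ^ n) \<le> 1 / real n ^ 2"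
      using alt_dilog_term_bound[of w n] mult_right_mono[of "cmod w" 1 "1 / real n ^ 2"]
      unfolding c_def by simp
  qed (rule summable_inverse_squares)
  moreover have "\<forall>\<^sub>F n in sequentially. continuous_on (cball 0 1) (\<lambda>w. \<Sum>i<n. c i * w ^ i)"
    by (intro always_eventually allI continuous_intros)
  ultimately show ?thesis unfolding alt_dilog_def[abs_def] c_def
    by (intro uniform_limit_theorem[of _ _ sequentially]) auto
qed

text \<open>Subtracting twice the even terms of the series of inverse squares flips their signs.
  They make up a quarter of the total pi^2/6, so half of it remains.\<close>

lemma alt_dilog_1: "alt_dilog 1 = of_real (pi\<^sup>2 / 12)"
proof -
  have "(\<lambda>n. 1 / real n ^ 2) sums (pi\<^sup>2 / 6)"
    using summable_inverse_squares suminf_inverse_squares by (simp add: sums_iff)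
  moreover from this have "(\<lambda>n. 1 / 2 * (1 / real n ^ 2)) sums (1 / 2 * (pi\<^sup>2 / 6))"
    by (rule sums_mult)
  then have "(\<lambda>n. if even n then 1 / 2 * (1 / real (n div 2) ^ 2) else 0) sums (1 / 2 * (pi\<^sup>2 / 6))"
    by (subst sums_mono_reindex[of "\<lambda>n. 2 * n", symmetric]) (auto simp: strict_mono_def elim!: evenE)
  ultimately have "(\<lambda>n. 1 / real n ^ 2 - (if even n then 1 / 2 * (1 / real (n div 2) ^ 2) else 0))
      sums (pi\<^sup>2 / 6 - 1 / 2 * (pi\<^sup>2 / 6))"
    by (rule sums_diff)
  also have "(\<lambda>n. 1 / real n ^ 2 - (if even n then 1 / 2 * (1 / real (n div 2) ^ 2) else 0))
      = (\<lambda>n. - ((-1) ^ n) / real n ^ 2)"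
    by (auto simp: fun_eq_iff power_mult_distrib elim!: evenE)
  finally have "(\<lambda>n. complex_of_real (- ((-1) ^ n) / real n ^ 2)) sums of_real (pi\<^sup>2 / 12)"
    by (subst sums_of_real_iff) simp
  then show ?thesis by (simp add: alt_dilog_def sums_iff)
qed

text \<open>The product \<open>w * d\<close> is what the chain rule for \<open>exp (- z)\<close>
  asks for, and it avoids a division at \<open>w = 0\<close>.\<close>

lemma alt_dilog_has_field_derivative:
  assumes "cmod w < 1"
  shows "\<exists>d. (alt_dilog has_field_derivative d) (at w) \<and> w * d = Ln (1 + w)"
proof -
  define c :: "nat \<Rightarrow> complex" where "c n = - ((-1) ^ n) / of_nat n ^ 2" for n
  have "summable (\<lambda>n. c n * 1 ^ n)"
    by (rule summable_comparison_test'[OF summable_inverse_squares, of 0])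
      (simp add: c_def norm_divide norm_power)
  then have "(alt_dilog has_field_derivative (\<Sum>n. diffs c n * w ^ n)) (at w)"
    and summable: "summable (\<lambda>n. diffs c n * w ^ n)"
    using termdiffs_strong[of c 1 w] termdiff_converges[of w 1 c] assms
      powser_inside[of c 1] unfolding alt_dilog_def[abs_def] c_def by auto
  moreover have "w * (\<Sum>n. diffs c n * w ^ n) = (\<Sum>n. - ((- w) ^ Suc n) / of_nat (Suc n))"
  proof -
    have "w * (diffs c n * w ^ n) = - ((- w) ^ Suc n) / of_nat (Suc n)" for n
      by (simp add: diffs_def c_def power2_eq_square power_minus[of w] del: of_nat_Suc)
    then show ?thesis using summable by (subst suminf_mult[symmetric]) auto
  qed
  moreover have "(\<lambda>n. - ((- w) ^ Suc n) / of_nat (Suc n)) sums Ln (1 + w)"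
    using Ln_series'[OF assms] by (subst sums_Suc_iff) simp
  ultimately show ?thesis by (auto simp: sums_iff)
qed

section \<open>The trapezoidal rule in a cone\<close>

abbreviation log1pexp :: "complex \<Rightarrow> complex" where
  "log1pexp z \<equiv> Ln (1 + exp (- z))"

lemma one_plus_exp_notin_nonpos:
  assumes "Re z > 0" shows "1 + exp (- z) \<notin> \<real>\<^sub>\<le>\<^sub>0"
proof -
  have "exp (- Re z) < 1" using assms by simp
  then have "\<bar>Re (exp (- z))\<bar> < 1"
    using abs_Re_le_cmod[of "exp (- z)"] unfolding norm_exp_eq_Re uminus_complex.sel by linarith
  then show ?thesis by (auto simp: complex_nonpos_Reals_iff)
qed

text \<open>The cone avoids the zeros of \<open>1 + exp (- z)\<close>: for \<open>Re z\<close> at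
  most 1 the cosine of \<open>Im z\<close> is nonnegative, and beyond that
  \<open>exp (- Re z)\<close> is at most 1/2.\<close>

lemma norm_one_plus_exp_ge:
  assumes "Re z \<ge> 0" "\<bar>Im z\<bar> \<le> Re z"
  shows "cmod (1 + exp (- z)) \<ge> 1 / 2"
proof (cases "Re z \<le> 1")
  case True
  then have "cos (Im z) \<ge> 0" using assms pi_half_gt_zero pi_ge_two by (intro cos_ge_zero) auto
  then have "Re (1 + exp (- z)) \<ge> 1" by (simp add: Re_exp)
  then show ?thesis using complex_Re_le_cmod[of "1 + exp (- z)"] by linarith
next
  case False
  then have "exp (- Re z) \<le> exp (- 1)" by simp
  also have "\<dots> \<le> (1 / 2 :: real)"
    using exp_ge_add_one_self[of 1] by (simp add: exp_minus field_simps)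
  finally show ?thesis using norm_diff_ineq[of 1 "exp (- z)"] by simp
qed

text \<open>Taylor expansion of the antiderivative and of its derivative at \<open>a\<close>: in the
  trapezoidal combination the terms up to second order cancel, and each remainder contributes half
  of the bound. The factor \<open>exp (- Re a)\<close> makes the errors summable along the multiples
  of \<open>t\<close>.\<close>

lemma trapezoid_step:
  assumes a: "Re a > 0" "\<bar>Im a\<bar> \<le> Re a" and t: "Re t > 0" "\<bar>Im t\<bar> \<le> Re t"
  shows "cmod (alt_dilog (exp (- a)) - alt_dilog (exp (- (a + t))) - t * (log1pexp a + log1pexp (a + t)) / 2)
    \<le> 4 * exp (- Re a) * cmod t ^ 3"
proof -
  define S where "S = closed_segment a (a + t)"
  have S: "Re z \<ge> Re a \<and> \<bar>Im z\<bar> \<le> Re z" if "z \<in> S" for z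
  proof -
    from that obtain u where "0 \<le> u" "u \<le> 1" "z = (1 - u) *\<^sub>R a + u *\<^sub>R (a + t)"
      by (auto simp: S_def closed_segment_def)
    then have u: "0 \<le> u" "u \<le> 1" "z = a + of_real u * t"
      by (simp_all add: scaleR_conv_of_real algebra_simps)
    then have "\<bar>Im z\<bar> \<le> \<bar>Im a\<bar> + u * \<bar>Im t\<bar>" by (simp add: abs_mult order.trans[OF abs_triangle_ineq])
    also have "\<dots> \<le> Re a + u * Re t" using a t u by (intro add_mono mult_left_mono) auto
    finally show ?thesis using u a t by simp
  qed
  define F where "F i = (if i = 0 then (\<lambda>z. alt_dilog (exp (- z)))
      else if i = 1 then (\<lambda>z. - log1pexp z)
      else if i = 2 then (\<lambda>z. exp (- z) / (1 + exp (- z)))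
      else (\<lambda>z. - exp (- z) / (1 + exp (- z)) ^ 2))" for i :: nat
  \<comment> \<open>Bounds the third derivative \<open>F 3\<close>; 4 is the inverse square of the
    lower bound 1/2 for \<open>cmod (1 + exp (- z))\<close>.\<close>
  define B where "B = 4 * exp (- Re a)"
  have deriv: "(F i has_field_derivative F (Suc i) z) (at z within S)" if z: "z \<in> S" and "i \<le> 2" for i z
  proof -
    have Re: "Re z > 0" using S[OF z] a by linarith
    have ne: "1 + exp (- z) \<noteq> 0" using one_plus_exp_notin_nonpos[OF Re] by auto
    consider "i = 0" | "i = 1" | "i = 2" using \<open>i \<le> 2\<close> by linarith
    then show ?thesis
    proof cases
      case 1
      obtain d where d: "(alt_dilog has_field_derivative d) (at (exp (- z)))" "exp (- z) * d = log1pexp z"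
        using alt_dilog_has_field_derivative[of "exp (- z)"] Re by auto
      have "((\<lambda>z. alt_dilog (exp (- z))) has_field_derivative d * (- exp (- z))) (at z)"
        by (rule DERIV_chain2[where g = "\<lambda>z. exp (- z)", OF d(1)]) (auto intro!: derivative_eq_intros)
      then show ?thesis using d(2) 1
        by (simp add: F_def mult.commute has_field_derivative_at_within)
    next
      case 2
      then show ?thesis unfolding F_def using one_plus_exp_notin_nonpos[OF Re] ne
        by (auto intro!: derivative_eq_intros simp: field_simps)
    next
      case 3
      then show ?thesis unfolding F_def using ne
        by (auto intro!: derivative_eq_intros simp: power2_eq_square algebra_simps)
    qed
  qed
  have bound: "cmod (F 3 z) \<le> B" if z: "z \<in> S" for z
  proof -
    have "1 / 4 \<le> cmod (1 + exp (- z)) ^ 2"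
      using power_mono[OF norm_one_plus_exp_ge[of z], of 2] S[OF z] a by (simp add: power2_eq_square)
    moreover have "exp (- Re z) \<le> exp (- Re a)" using S[OF z] by simp
    ultimately have "exp (- Re z) / cmod (1 + exp (- z)) ^ 2 \<le> exp (- Re a) / (1 / 4)"
      by (intro frac_le) auto
    then show ?thesis by (simp add: F_def B_def norm_divide norm_power)
  qed
  have conv: "convex S" and mem: "a \<in> S" "a + t \<in> S" by (auto simp: S_def)
  have "cmod (F 0 (a + t) - (\<Sum>i\<le>2. F i a * (a + t - a) ^ i / fact i)) \<le> B * cmod (a + t - a) ^ Suc 2 / fact 2"
    by (rule complex_Taylor[OF conv]) (use deriv bound mem in \<open>auto simp: numeral_3_eq_3\<close>)
  then have 1: "cmod (F 0 (a + t) - F 0 a - F 1 a * t - F 2 a * t\<^sup>2 / 2) \<le> B * cmod t ^ 3 / 2"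
    by (simp add: numeral_2_eq_2 atMost_Suc power3_eq_cube algebra_simps)
  have "cmod (F (Suc 0) (a + t) - (\<Sum>i\<le>1. F (Suc i) a * (a + t - a) ^ i / fact i)) \<le> B * cmod (a + t - a) ^ Suc 1 / fact 1"
    by (rule complex_Taylor[OF conv, of 1 "\<lambda>i. F (Suc i)"]) (use deriv bound mem in \<open>auto simp: numeral_3_eq_3\<close>)
  then have 2: "cmod (F 1 (a + t) - F 1 a - F 2 a * t) \<le> B * cmod t ^ 2"
    by (simp add: numeral_2_eq_2 atMost_Suc algebra_simps)
  have "F 0 a - F 0 (a + t) + t * (F 1 a + F 1 (a + t)) / 2 
      = t / 2 * (F 1 (a + t) - F 1 a - F 2 a * t) - (F 0 (a + t) - F 0 a - F 1 a * t - F 2 a * t\<^sup>2 / 2)"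
    by (simp add: algebra_simps power2_eq_square)
  also have "cmod \<dots> \<le> cmod t / 2 * (B * cmod t ^ 2) + B * cmod t ^ 3 / 2"
    by (rule order.trans[OF norm_triangle_ineq4 add_mono])
      (use mult_left_mono[OF 2, of "cmod t / 2"] 1 in \<open>simp_all add: norm_mult norm_divide\<close>)
  also have "\<dots> = B * cmod t ^ 3" by (simp add: power2_eq_square power3_eq_cube)
  finally show ?thesis by (simp add: F_def B_def algebra_simps diff_divide_distrib add_divide_distrib)
qed

text \<open>The antiderivative is not analytic at the left endpoint \<open>0\<close>, which is reached by continuity.\<close>

lemma trapezoid_step_0:
  assumes t: "Re t > 0" "\<bar>Im t\<bar> \<le> Re t"
  shows "cmod (alt_dilog (exp 0) - alt_dilog (exp (- t)) - t * (log1pexp 0 + log1pexp t) / 2) \<le> 4 * cmod t ^ 3"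
proof -
  define f where "f u = cmod (alt_dilog (exp (- (of_real u * t))) - alt_dilog (exp (- (of_real u * t + t)))
      - t * (log1pexp (of_real u * t) + log1pexp (of_real u * t + t)) / 2)" for u
  have notin: "1 + exp (- (of_real u * t + s)) \<notin> \<real>\<^sub>\<le>\<^sub>0" if "u \<ge> 0" "s = 0 \<or> s = t" for u s
  proof (cases "u = 0 \<and> s = 0")
    case False
    then have "Re (of_real u * t + s) > 0" using that t by (auto simp: add_pos_pos add_nonneg_pos)
    then show ?thesis by (rule one_plus_exp_notin_nonpos)
  qed simp
  have "- (u * Re t) \<le> Re t" if "u \<ge> 0" for u
    using mult_nonneg_nonneg[OF that, of "Re t"] t by linarith
  then have "continuous_on {0..} f" unfolding f_def
    by (intro continuous_intros continuous_on_compose2[OF continuous_on_alt_dilog])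
      (use notin[of _ 0] notin[of _ t] t in auto)
  then have "(f \<longlongrightarrow> f 0) (at 0 within {0..})" by (simp add: continuous_on_def)
  then have lim: "(f \<longlongrightarrow> f 0) (at_right 0)" by (rule tendsto_within_subset) auto
  have "f u \<le> 4 * cmod t ^ 3" if "u > 0" for u
  proof -
    have "f u \<le> 4 * exp (- Re (of_real u * t)) * cmod t ^ 3"
      unfolding f_def by (rule trapezoid_step) (use t that in \<open>auto simp: abs_mult\<close>)
    also have "\<dots> \<le> 4 * 1 * cmod t ^ 3" using t that by (intro mult_right_mono mult_left_mono) auto
    finally show ?thesis by simp
  qed
  then have "f 0 \<le> 4 * cmod t ^ 3"
    by (intro tendsto_upperbound[OF lim] eventually_at_rightI[of 0 1]) auto
  then show ?thesis by (simp add: f_def)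
qed

text \<open>The trapezoidal errors add up to a geometric series. \<open>P 0\<close> yields the main
  term, the half weight of the left endpoint value \<open>ln 2\<close> yields the constant, and the
  right endpoint yields the exponentially small terms.\<close>

lemma sum_log1pexp_asymp:
  assumes t: "Re t > 0" "\<bar>Im t\<bar> \<le> Re t" and n: "exp (- real n * Re t) < 1 / 2"
  shows "cmod ((\<Sum>k=1..n. log1pexp (of_nat k * t)) - (of_real (pi\<^sup>2 / 12) / t - of_real (ln 2 / 2)))
    \<le> 4 * cmod t ^ 2 / (1 - exp (- Re t)) + 3 * exp (- real n * Re t) / cmod t + exp (- real n * Re t)"
proof -
  define P where "P k = alt_dilog (exp (- (of_nat k * t)))" for k
  define f where "f k = log1pexp (of_nat k * t)" for k
  have t0: "t \<noteq> 0" using t by auto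
  have step: "cmod (P k - P (Suc k) - t * (f k + f (Suc k)) / 2) \<le> 4 * cmod t ^ 3 * exp (- Re t) ^ k" for k
  proof (cases "k = 0")
    case True
    then show ?thesis using trapezoid_step_0[OF t] by (simp add: P_def f_def)
  next
    case False
    have "\<bar>Im (of_nat k * t)\<bar> \<le> Re (of_nat k * t)"
      using t mult_left_mono[OF t(2), of "real k"] by (simp add: abs_mult)
    then have "cmod (P k - P (Suc k) - t * (f k + f (Suc k)) / 2) \<le> 4 * exp (- Re (of_nat k * t)) * cmod t ^ 3"
      unfolding P_def f_def using trapezoid_step[of "of_nat k * t" t] t False
      by (simp add: algebra_simps)
    then show ?thesis by (simp add: exp_of_nat_mult[symmetric] mult_ac)
  qed
  have "(\<Sum>k<n. P k - P (Suc k) - t * (f k + f (Suc k)) / 2)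
      = P 0 - P n - t * ((\<Sum>k=1..n. f k) + (f 0 - f n) / 2)"
    by (induction n) (simp_all add: algebra_simps add_divide_distrib diff_divide_distrib)
  moreover have "cmod (\<Sum>k<n. P k - P (Suc k) - t * (f k + f (Suc k)) / 2)
      \<le> (\<Sum>k<n. 4 * cmod t ^ 3 * exp (- Re t) ^ k)"
    by (rule sum_norm_le) (rule step)
  moreover have "(\<Sum>k<n. 4 * cmod t ^ 3 * exp (- Re t) ^ k) \<le> 4 * cmod t ^ 3 / (1 - exp (- Re t))"
  proof -
    have "(\<Sum>k<n. exp (- Re t) ^ k) \<le> (\<Sum>k. exp (- Re t) ^ k)"
      using t by (intro sum_le_suminf summable_geometric) auto
    also have "\<dots> = 1 / (1 - exp (- Re t))" using t by (intro suminf_geometric) auto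
    finally have "4 * cmod t ^ 3 * (\<Sum>k<n. exp (- Re t) ^ k) \<le> 4 * cmod t ^ 3 * (1 / (1 - exp (- Re t)))"
      by (rule mult_left_mono) simp
    then show ?thesis by (simp add: sum_distrib_left)
  qed
  ultimately have "cmod (P 0 - P n - t * ((\<Sum>k=1..n. f k) + (f 0 - f n) / 2)) \<le> 4 * cmod t ^ 3 / (1 - exp (- Re t))"
    by simp
  then have *: "cmod (P 0 - P n - t * ((\<Sum>k=1..n. f k) + (f 0 - f n) / 2)) / cmod t
      \<le> 4 * cmod t ^ 2 / (1 - exp (- Re t))"
    using t0 by (simp add: field_simps power2_eq_square power3_eq_cube)
  have f0: "f 0 = of_real (ln 2)" by (simp add: f_def flip: Ln_of_real)
  have P0: "P 0 = of_real (pi\<^sup>2 / 12)" by (simp add: P_def alt_dilog_1)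
  have nexp: "cmod (exp (- (of_nat n * t))) = exp (- real n * Re t)" by simp
  have fn: "cmod (f n) \<le> 2 * exp (- real n * Re t)"
    unfolding f_def using norm_Ln_le[of "exp (- (of_nat n * t))"] nexp n by simp
  have Pn: "cmod (P n) \<le> 3 * exp (- real n * Re t)"
    unfolding P_def using norm_alt_dilog_le[of "exp (- (of_nat n * t))"] nexp n by linarith
  have "(\<Sum>k=1..n. f k) - (of_real (pi\<^sup>2 / 12) / t - of_real (ln 2 / 2))
      = - (P 0 - P n - t * ((\<Sum>k=1..n. f k) + (f 0 - f n) / 2)) / t - P n / t + f n / 2"
    using t0 by (simp add: f0 P0 field_simps)
  also have "cmod \<dots> \<le> 4 * cmod t ^ 2 / (1 - exp (- Re t)) + 3 * exp (- real n * Re t) / cmod t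
      + exp (- real n * Re t)"
    using * fn divide_right_mono[OF Pn, of "cmod t"]
    by (intro order.trans[OF norm_triangle_ineq] order.trans[OF norm_triangle_ineq4] add_mono)
      (auto simp: norm_divide norm_minus_commute)
  finally show ?thesis by (simp add: f_def)
qed

section \<open>A bound on the whole circle\<close>

text \<open>With \<open>r = exp (- Re z)\<close> the squared modulus is
  \<open>(1 + r)\<^sup>2 - 2 * r * (1 - cos (Im z))\<close>. Since \<open>r\<close> is at least 1/3
  and \<open>(1 + r)\<^sup>2\<close> at most 4, \<open>2 * r\<close> is at least
  \<open>(1 + r)\<^sup>2 / 6\<close>; the square root turns 6 into 12.\<close>

lemma norm_one_plus_exp_le:
  assumes "Re z \<ge> 0" "Re z \<le> 1"
  shows "cmod (1 + exp (- z)) \<le> (1 + exp (- Re z)) * exp (- (1 - cos (Im z)) / 12)"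
proof -
  define r where "r = exp (- Re z)"
  have r: "r > 0" "r \<le> 1" "1 / 3 \<le> r"
  proof -
    have "exp (1 :: real) \<le> 3" by (rule exp_le)
    then have "1 / 3 \<le> exp (- 1 :: real)" by (simp add: exp_minus field_simps)
    also have "\<dots> \<le> r" using assms by (simp add: r_def)
    finally show "1 / 3 \<le> r" .
  qed (use assms in \<open>auto simp: r_def\<close>)
  have "(cmod (1 + exp (- z)))\<^sup>2 = (1 + r * cos (Im z))\<^sup>2 + (r * sin (Im z))\<^sup>2"
    by (simp add: cmod_power2 Re_exp Im_exp r_def)
  also have "\<dots> = (1 + r)\<^sup>2 - 2 * r * (1 - cos (Im z)) + r\<^sup>2 * ((sin (Im z))\<^sup>2 + (cos (Im z))\<^sup>2 - 1)"
    by algebra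
  also have "\<dots> = (1 + r)\<^sup>2 - 2 * r * (1 - cos (Im z))" by simp
  also have "\<dots> \<le> (1 + r)\<^sup>2 - (1 + r)\<^sup>2 / 6 * (1 - cos (Im z))"
  proof -
    have "(1 + r)\<^sup>2 \<le> 2\<^sup>2" using r by (intro power_mono) auto
    then show ?thesis using r by (intro diff_left_mono mult_right_mono) auto
  qed
  also have "\<dots> = (1 + r)\<^sup>2 * (1 + - (1 - cos (Im z)) / 6)" by (simp add: field_simps)
  also have "\<dots> \<le> (1 + r)\<^sup>2 * exp (- (1 - cos (Im z)) / 6)"
    by (intro mult_left_mono exp_ge_add_one_self) auto
  also have "\<dots> = ((1 + r) * exp (- (1 - cos (Im z)) / 12))\<^sup>2"
    by (simp add: power_mult_distrib flip: exp_of_nat_mult)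
  finally show ?thesis unfolding r_def by (rule power2_le_imp_le) auto
qed

text \<open>Cancellation is exploited only for \<open>k\<close> up to \<open>K\<close>, where
  \<open>k * Re t\<close> is at most 1; the other factors get the triangle inequality.\<close>

lemma norm_prod_one_plus_exp_le:
  assumes "Re t > 0" "K \<le> n" "real K * Re t \<le> 1"
  shows "cmod (\<Prod>k=1..n. 1 + exp (- (of_nat k * t)))
    \<le> (\<Prod>k=1..n. 1 + exp (- (real k * Re t))) * exp (- (\<Sum>k=1..K. 1 - cos (real k * Im t)) / 12)"
proof -
  define h where "h k = (if k \<le> K then exp (- (1 - cos (real k * Im t)) / 12) else 1)" for k
  have "cmod (\<Prod>k=1..n. 1 + exp (- (of_nat k * t))) \<le> (\<Prod>k=1..n. (1 + exp (- (real k * Re t))) * h k)"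
    unfolding prod_norm[symmetric]
  proof (intro prod_mono conjI norm_ge_zero)
    fix k
    show "cmod (1 + exp (- (of_nat k * t))) \<le> (1 + exp (- (real k * Re t))) * h k"
    proof (cases "k \<le> K")
      case True
      then have "real k * Re t \<le> real K * Re t" using assms by (intro mult_right_mono) auto
      then have "real k * Re t \<le> 1" using assms by linarith
      then show ?thesis using norm_one_plus_exp_le[of "of_nat k * t"] assms True by (simp add: h_def)
    next
      case False
      then show ?thesis using norm_triangle_ineq[of 1 "exp (- (of_nat k * t))"] by (simp add: h_def)
    qed
  qed
  also have "\<dots> = (\<Prod>k=1..n. 1 + exp (- (real k * Re t))) * (\<Prod>k=1..n. h k)"
    by (rule prod.distrib)
  also have "(\<Prod>k=1..n. h k) = (\<Prod>k=1..K. exp (- (1 - cos (real k * Im t)) / 12))"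
  proof -
    have "{1..n} \<inter> {k. k \<le> K} = {1..K}" using assms by auto
    then show ?thesis by (simp add: h_def prod.If_cases)
  qed
  also have "\<dots> = exp (- (\<Sum>k=1..K. 1 - cos (real k * Im t)) / 12)"
    by (simp flip: exp_sum sum_negf sum_divide_distrib)
  finally show ?thesis .
qed

section \<open>Lower bounds for sums of 1 - cos\<close>

text \<open>On this interval \<open>x ^ 3\<close> is at most \<open>4 * x\<close>, so the cubic
  Taylor bound leaves \<open>x - 4 * x / 6\<close>.\<close>

lemma sin_ge_third:
  fixes x :: real
  assumes "0 \<le> x" "x \<le> 2"
  shows "x / 3 \<le> sin x"
proof -
  have "\<bar>sin x - x\<bar> \<le> x ^ 3 / 6"
    using Maclaurin_sin_bound[of x 3] assms
    by (simp add: numeral_3_eq_3 sin_coeff_def fact_numeral field_simps)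
  moreover have "x ^ 3 \<le> x * 4"
    using assms mult_left_mono[OF power_mono[of x 2 2], of x]
    by (simp add: power3_eq_cube power2_eq_square mult.assoc)
  ultimately show ?thesis by linarith
qed

lemma one_minus_cos_ge:
  fixes x :: real
  assumes "0 \<le> x" "x \<le> 4"
  shows "x\<^sup>2 / 18 \<le> 1 - cos x"
proof -
  have "1 - cos x = 2 * (sin (x / 2))\<^sup>2" using cos_double_sin[of "x / 2"] by simp
  moreover have "(x / 2 / 3)\<^sup>2 \<le> (sin (x / 2))\<^sup>2"
    using assms sin_ge_third[of "x / 2"] by (intro power_mono) auto
  ultimately show ?thesis by (simp add: power_divide)
qed

text \<open>If \<open>K * y\<close> is at most 4, the quadratic bound for each cosine is summed; the
  squares add up to at least \<open>K ^ 3 / 3\<close>, and \<open>54 = 3 * 18\<close>. Otherwise the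
  closed form of the Dirichlet kernel shows that the cosines average at most 3/4.\<close>

lemma sum_one_minus_cos_ge_pos:
  fixes y :: real
  assumes "0 < y" "y \<le> pi" "K \<ge> 1"
  shows "min (real K ^ 3 * y\<^sup>2 / 54) (real K / 4) \<le> (\<Sum>k=1..K. 1 - cos (real k * y))"
proof (cases "real K * y \<le> 4")
  case True
  have "real K ^ 3 / 3 \<le> (\<Sum>k=1..K. real k ^ 2)"
    by (induction K) (simp_all add: power2_eq_square power3_eq_cube algebra_simps)
  then have "real K ^ 3 / 3 * (y\<^sup>2 / 18) \<le> (\<Sum>k=1..K. real k ^ 2) * (y\<^sup>2 / 18)"
    by (rule mult_right_mono) simp
  also have "\<dots> = (\<Sum>k=1..K. (real k * y)\<^sup>2 / 18)"
    by (simp add: sum_distrib_right power_mult_distrib)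
  also have "\<dots> \<le> (\<Sum>k=1..K. 1 - cos (real k * y))"
  proof (rule sum_mono)
    fix k assume "k \<in> {1..K}"
    then have "real k * y \<le> real K * y" using assms by (intro mult_right_mono) auto
    then have "real k * y \<le> 4" using True by linarith
    then show "(real k * y)\<^sup>2 / 18 \<le> 1 - cos (real k * y)"
      using assms by (intro one_minus_cos_ge) auto
  qed
  finally show ?thesis by simp
next
  case False
  have s: "y / 6 \<le> sin (y / 2)" using assms pi_less_4 sin_ge_third[of "y / 2"] by simp
  have "2 * sin (y / 2) * (\<Sum>k=1..K. cos (real k * y)) = sin (real K * y + y / 2) - sin (y / 2)"
  proof (induction K)
    case (Suc K)
    have "2 * sin (y / 2) * cos (real (Suc K) * y)
        = sin (real (Suc K) * y + y / 2) - sin (real (Suc K) * y - y / 2)"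
      unfolding sin_add sin_diff by simp
    moreover have "real (Suc K) * y - y / 2 = real K * y + y / 2" by (simp add: field_simps)
    ultimately show ?case using Suc.IH by (simp add: distrib_left add.commute)
  qed simp
  also have "\<dots> \<le> 1" using sin_le_one[of "real K * y + y / 2"] s assms by linarith
  finally have 1: "2 * sin (y / 2) * (\<Sum>k=1..K. cos (real k * y)) \<le> 1" .
  \<comment> \<open>Since \<open>sin (y / 2)\<close> is at least \<open>y / 6\<close> and
    \<open>K * y > 4\<close>, a larger sum would push the product above
    \<open>K * y / 4 > 1\<close>.\<close>
  have "(\<Sum>k=1..K. cos (real k * y)) \<le> 3 * real K / 4"
  proof (rule ccontr)
    assume *: "\<not> ?thesis"
    then have "2 * (y / 6) * (3 * real K / 4) < 2 * sin (y / 2) * (\<Sum>k=1..K. cos (real k * y))"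
      using s assms by (intro mult_le_less_imp_less) auto
    moreover have "2 * (y / 6) * (3 * real K / 4) > 1" using False by (simp add: field_simps)
    ultimately show False using 1 by linarith
  qed
  then show ?thesis by (simp add: sum_subtractf)
qed

lemma sum_one_minus_cos_ge:
  fixes y :: real
  assumes "\<bar>y\<bar> \<le> pi" "K \<ge> 1"
  shows "min (real K ^ 3 * y\<^sup>2 / 54) (real K / 4) \<le> (\<Sum>k=1..K. 1 - cos (real k * y))"
proof -
  consider "y = 0" | "y > 0" | "y < 0" by linarith
  then show ?thesis
  proof cases
    case 3
    then show ?thesis using sum_one_minus_cos_ge_pos[of "- y" K] assms by simp
  qed (use sum_one_minus_cos_ge_pos[of y K] assms in auto)
qed

text \<open>The constant is \<open>27 \<cdot> 32768 \<cdot> 4\<^sup>2\<close>, from \<open>exp u \<ge> (1 + u/3)\<^sup>3\<close> with \<open>u = 1 / (32 x)\<close> and \<open>\<pi> < 4\<close>.\<close>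

lemma exp_neg_min_le:
  fixes s x :: real
  assumes "0 < x" "s\<^sup>2 * x ^ 3 \<le> pi\<^sup>2"
  shows "exp (- min (s\<^sup>2 / 1728) (1 / (32 * x))) \<le> 14155776 / (1 + s\<^sup>2)"
proof (cases "s\<^sup>2 / 1728 \<le> 1 / (32 * x)")
  case True
  have "1 + s\<^sup>2 \<le> 1728 * (1 + s\<^sup>2 / 1728)" by simp
  also have "\<dots> \<le> 1728 * exp (s\<^sup>2 / 1728)" by (intro mult_left_mono exp_ge_add_one_self) auto
  also have "\<dots> \<le> 14155776 * exp (s\<^sup>2 / 1728)" by simp
  finally show ?thesis using True by (simp add: exp_minus field_simps add_pos_nonneg)
next
  case False
  define u where "u = 1 / (32 * x)"
  have u: "u > 0" using assms by (simp add: u_def)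
  have "s\<^sup>2 \<le> pi\<^sup>2 / x ^ 3" using assms by (simp add: field_simps)
  also have "\<dots> \<le> 4\<^sup>2 / x ^ 3" using assms pi_less_4 by (intro divide_right_mono power_mono) auto
  also have "\<dots> = 524288 * u ^ 3" by (simp add: u_def power_divide power_mult_distrib)
  finally have "1 + s\<^sup>2 \<le> 14155776 * (1 + u ^ 3 / 27)" by simp
  also have "\<dots> \<le> 14155776 * (1 + u / 3) ^ 3"
    using u by (intro mult_left_mono) (auto simp: power3_eq_cube field_simps)
  also have "\<dots> \<le> 14155776 * exp (u / 3) ^ 3"
    using u by (intro mult_left_mono power_mono exp_ge_add_one_self) auto
  also have "exp (u / 3) ^ 3 = exp u" by (simp flip: exp_of_nat_mult)
  finally have "exp (- u) \<le> 14155776 / (1 + s\<^sup>2)"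
    by (simp add: exp_minus field_simps add_pos_nonneg)
  moreover have "min (s\<^sup>2 / 1728) (1 / (32 * x)) = u" using False by (simp add: u_def)
  ultimately show ?thesis by simp
qed

lemma norm_prod_one_plus_exp_cubed_le:
  assumes x: "0 < x" "x \<le> 1 / 2" and n: "1 \<le> real n * x" and y: "\<bar>y\<bar> \<le> pi" and s: "y = s * x powr (3 / 2)"
  shows "cmod (\<Prod>k=1..n. 1 + exp (- (of_nat k * Complex x y))) ^ 3
    \<le> (\<Prod>k=1..n. 1 + exp (- (real k * x))) ^ 3 * (14155776 / (1 + s\<^sup>2))"
proof -
  \<comment> \<open>The largest \<open>K\<close> with \<open>K * x\<close> at most 1; as
    \<open>x\<close> is at most 1/2, it is at least \<open>1 / (2 * x)\<close>.\<close>
  define K where "K = nat \<lfloor>1 / x\<rfloor>"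
  have K1: "real K \<le> 1 / x" using x by (simp add: K_def)
  have "1 / x - 1 \<le> real K" using x unfolding K_def by linarith
  moreover have "1 \<le> 1 / (2 * x)" using x by (simp add: field_simps)
  ultimately have K2: "1 / (2 * x) \<le> real K" by (simp add: field_simps)
  have K3: "K \<ge> 1" using K2 \<open>1 \<le> 1 / (2 * x)\<close> by linarith
  have "1 / x \<le> real n" using n x by (simp add: field_simps)
  then have Kn: "K \<le> n" using K1 by linarith
  have Kx: "real K * x \<le> 1" using K1 x by (simp add: field_simps)
  have sx: "y\<^sup>2 = s\<^sup>2 * x ^ 3"
    using x by (simp add: s power_mult_distrib powr_power powr_numeral)
  \<comment> \<open>The powers of \<open>x\<close> cancel, leaving
    \<open>432 = 8 * 54\<close>.\<close>
  have "s\<^sup>2 / 432 = (1 / (2 * x)) ^ 3 * y\<^sup>2 / 54"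
    using x by (simp add: sx power_divide power_mult_distrib)
  also have "\<dots> \<le> real K ^ 3 * y\<^sup>2 / 54"
    using K2 x by (intro divide_right_mono mult_right_mono power_mono) auto
  finally have "s\<^sup>2 / 432 \<le> real K ^ 3 * y\<^sup>2 / 54" .
  moreover have "1 / (8 * x) \<le> real K / 4" using K2 by simp
  ultimately have m: "min (s\<^sup>2 / 432) (1 / (8 * x)) \<le> (\<Sum>k=1..K. 1 - cos (real k * y))"
    using sum_one_minus_cos_ge[OF y K3] by linarith
  \<comment> \<open>Cubing the product turns the 12 in the exponent into 4, whence
    \<open>1728 = 4 * 432\<close> and \<open>32 = 4 * 8\<close>.\<close>
  have m': "min (s\<^sup>2 / 1728) (1 / (32 * x)) = min (s\<^sup>2 / 432) (1 / (8 * x)) / 4"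
    by (simp add: min_def field_simps)
  have le: "min (s\<^sup>2 / 1728) (1 / (32 * x)) \<le> (\<Sum>k=1..K. 1 - cos (real k * y)) / 4"
    unfolding m' by (rule divide_right_mono[OF m]) simp
  have "cmod (\<Prod>k=1..n. 1 + exp (- (of_nat k * Complex x y)))
    \<le> (\<Prod>k=1..n. 1 + exp (- (real k * x))) * exp (- (\<Sum>k=1..K. 1 - cos (real k * y)) / 12)"
    using norm_prod_one_plus_exp_le[of "Complex x y" K n] x Kn Kx by simp
  then have "cmod (\<Prod>k=1..n. 1 + exp (- (of_nat k * Complex x y))) ^ 3
    \<le> ((\<Prod>k=1..n. 1 + exp (- (real k * x))) * exp (- (\<Sum>k=1..K. 1 - cos (real k * y)) / 12)) ^ 3"
    by (rule power_mono) simp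
  also have "\<dots> = (\<Prod>k=1..n. 1 + exp (- (real k * x))) ^ 3 * exp (- ((\<Sum>k=1..K. 1 - cos (real k * y)) / 4))"
    by (simp add: power_mult_distrib flip: exp_of_nat_mult)
  also have "\<dots> \<le> (\<Prod>k=1..n. 1 + exp (- (real k * x))) ^ 3 * exp (- min (s\<^sup>2 / 1728) (1 / (32 * x)))"
    using le by (intro mult_left_mono) (auto intro!: zero_le_power prod_nonneg add_nonneg_nonneg)
  also have "\<dots> \<le> (\<Prod>k=1..n. 1 + exp (- (real k * x))) ^ 3 * (14155776 / (1 + s\<^sup>2))"
  proof (intro mult_left_mono exp_neg_min_le)
    show "s\<^sup>2 * x ^ 3 \<le> pi\<^sup>2"
      unfolding sx[symmetric] using y by (metis abs_le_square_iff abs_of_pos pi_gt_zero)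
  qed (use x in \<open>auto intro!: zero_le_power prod_nonneg add_nonneg_nonneg\<close>)
  finally show ?thesis .
qed

section \<open>The saddle point integral\<close>

lemma exp_int_multiple_has_integral:
  "((\<lambda>y. exp (of_int d * Complex x y)) has_integral (if d = 0 then 2 * of_real pi else 0)) {-pi..pi}"
proof (cases "d = 0")
  case True
  then show ?thesis using has_integral_const_real[of "1 :: complex" "-pi" pi]
    by (simp add: scaleR_conv_of_real)
next
  case False
  have "((\<lambda>y. exp (of_int d * Complex x y)) has_integral
      exp (of_int d * Complex x pi) / (of_int d * \<i>) - exp (of_int d * Complex x (-pi)) / (of_int d * \<i>)) {-pi..pi}"
  proof (rule fundamental_theorem_of_calculus)
    fix y
    have "((\<lambda>w. exp (of_int d * (of_real x + \<i> * w)) / (of_int d * \<i>)) has_field_derivative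
        exp (of_int d * (of_real x + \<i> * of_real y))) (at (of_real y))"
      using False by (auto intro!: derivative_eq_intros)
    then show "((\<lambda>y. exp (of_int d * Complex x y) / (of_int d * \<i>)) has_vector_derivative
        exp (of_int d * Complex x y)) (at y within {-pi..pi})"
      unfolding Complex_eq
      by (intro has_vector_derivative_real_field) (auto intro: has_field_derivative_at_within)
  qed simp
  moreover have "exp (of_int d * Complex x pi) = exp (of_int d * Complex x (-pi))"
    by (subst exp_eq, rule exI[of _ d]) (simp add: Complex_eq algebra_simps)
  ultimately show ?thesis using False by simp
qed

lemma coeff_eq_integral:
  fixes p :: "complex poly"
  shows "(LINT y:{-pi..pi}|lborel. poly p (exp (- Complex x y)) * exp (of_nat n * Complex x y))
    = 2 * of_real pi * coeff p n"
proof -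
  define f where "f y = poly p (exp (- Complex x y)) * exp (of_nat n * Complex x y)" for y
  \<comment> \<open>Summing up to \<open>max n (degree p)\<close> keeps the index \<open>n\<close>
    in range even when it exceeds the degree.\<close>
  have f: "f y = (\<Sum>i\<le>max n (degree p). coeff p i * exp (of_int (int n - int i) * Complex x y))" for y
  proof -
    have "poly p z = (\<Sum>i\<le>max n (degree p). coeff p i * z ^ i)" for z
      unfolding poly_altdef by (rule sum.mono_neutral_left) (auto simp: coeff_eq_0)
    moreover have "exp (- Complex x y) ^ i * exp (of_nat n * Complex x y)
        = exp (of_int (int n - int i) * Complex x y)" for i
      by (simp add: algebra_simps flip: exp_of_nat_mult exp_add)
    ultimately show ?thesis
      by (simp only: f_def sum_distrib_right mult.assoc)
  qed
  have "(f has_integral (\<Sum>i\<le>max n (degree p). coeff p i * (if int n - int i = 0 then 2 * of_real pi else 0))) {-pi..pi}"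
    unfolding f[abs_def]
    by (intro has_integral_sum has_integral_mult_right exp_int_multiple_has_integral) auto
  also have "(\<Sum>i\<le>max n (degree p). coeff p i * (if int n - int i = 0 then 2 * of_real pi else 0))
      = (\<Sum>i\<le>max n (degree p). if i = n then 2 * of_real pi * coeff p n else 0)"
    by (rule sum.cong) auto
  also have "\<dots> = 2 * of_real pi * coeff p n"
    by simp
  finally have "integral {-pi..pi} f = 2 * of_real pi * coeff p n"
    by (rule integral_unique)
  moreover have "set_integrable lborel {-pi..pi} f"
    unfolding f_def Complex_eq by (intro borel_integrable_atLeastAtMost' continuous_intros)
  ultimately show ?thesis
    using set_borel_integral_eq_integral(2)[of "{-pi..pi}" f] by (simp add: f_def[abs_def])
qed

section \<open>Gaussian scaling at the saddle point\<close>

lemma integrable_divide_1_plus_square: "integrable lborel (\<lambda>s::real. C / (1 + s\<^sup>2))"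
proof -
  have "integrable lborel (\<lambda>s::real. inverse (1 + s\<^sup>2))"
    using integrable_inverse_1_plus_square by (simp add: set_integrable_def einterval_def)
  then show ?thesis by (simp add: divide_inverse)
qed

lemma integral_gaussian:
  assumes "a > 0"
  shows "(\<integral>s. exp (- a * s\<^sup>2) \<partial>lborel) = sqrt (pi / a)"
proof -
  define \<sigma> where "\<sigma> = 1 / sqrt (2 * a)"
  have s2: "\<sigma>\<^sup>2 = 1 / (2 * a)" using assms by (simp add: \<sigma>_def power_divide)
  have "exp (- a * s\<^sup>2) = sqrt (pi / a) * normal_density 0 \<sigma> s" for s
    using assms by (simp add: normal_density_def s2)
  moreover have "\<sigma> > 0" using assms by (simp add: \<sigma>_def)
  ultimately show ?thesis by simp
qed

text \<open>The minimiser of pi^2/(4x) + n x, the exponent formed by three times the main term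
  pi^2/(12x) and the factor exp(n x).\<close>

definition saddle :: "nat \<Rightarrow> real" where
  "saddle n = pi / (2 * sqrt (real n))"

text \<open>The value of the integrand at the saddle point is of order \<open>exp (2 n x) = exp (\<pi> \<surd>n)\<close>.\<close>

definition normalized_integrand :: "nat \<Rightarrow> real \<Rightarrow> complex" where
  "normalized_integrand n s = (let t = Complex (saddle n) (s * saddle n powr (3 / 2)) in
     (\<Prod>k=1..n. 1 + exp (- (of_nat k * t))) ^ 3 * exp (of_nat n * t - of_real (pi * sqrt (real n))))"

text \<open>The substitution \<open>y = s * x powr (3 / 2)\<close> gives the peak a width
  independent of \<open>n\<close>; the indicator records the range of the angle. Stopping the
  product at \<open>n\<close> suffices for coefficient \<open>n\<close>.\<close>

lemma sigma_overline_mex_eq_integral: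
  assumes "n > 0"
  shows "of_nat (sigma_overline_mex n) = of_real (saddle n powr (3 / 2) * exp (pi * sqrt (real n)) / (2 * pi)) *
    (\<integral>s. indicator {-pi..pi} (s * saddle n powr (3 / 2)) *\<^sub>R normalized_integrand n s \<partial>lborel)"
proof -
  define x where "x = saddle n"
  define w where "w = x powr (3 / 2)"
  have w: "w > 0" using assms by (simp add: w_def x_def saddle_def)
  define p :: "complex poly" where "p = (\<Prod>k=1..n. 1 + monom 1 k) ^ 3"
  define f where "f y = poly p (exp (- Complex x y)) * exp (of_nat n * Complex x y)" for y
  define I where "I = (\<integral>s. indicator {-pi..pi} (s * w) *\<^sub>R normalized_integrand n s \<partial>lborel)"
  have p: "poly p (exp (- t)) = (\<Prod>k=1..n. 1 + exp (- (of_nat k * t))) ^ 3" for t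
    by (simp add: p_def poly_prod poly_monom flip: exp_of_nat_mult)
  have "2 * of_real pi * of_nat (sigma_overline_mex n) = (LINT y:{-pi..pi}|lborel. f y)"
    unfolding f_def coeff_eq_integral by (simp add: sigma_overline_mex_eq_coeff[of n n] p_def)
  also have "\<dots> = w *\<^sub>R (\<integral>s. indicator {-pi..pi} (s * w) *\<^sub>R f (s * w) \<partial>lborel)"
    unfolding set_lebesgue_integral_def using w
    by (subst lborel_integral_real_affine[of w _ 0]) (auto simp: mult.commute)
  also have "(\<integral>s. indicator {-pi..pi} (s * w) *\<^sub>R f (s * w) \<partial>lborel) =
      of_real (exp (pi * sqrt (real n))) * I"
    unfolding I_def integral_mult_right_zero[symmetric]
    by (rule Bochner_Integration.integral_cong)
      (simp_all add: normalized_integrand_def f_def p Let_def w_def x_def exp_diff flip: exp_of_real)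
  finally have "of_nat (sigma_overline_mex n) = of_real (w * exp (pi * sqrt (real n)) / (2 * pi)) * I"
    by (simp add: scaleR_conv_of_real field_simps)
  then show ?thesis by (simp only: w_def x_def I_def)
qed

lemma saddle_facts:
  assumes "n \<ge> 16"
  shows "0 < saddle n" "saddle n \<le> 1 / 2" "1 \<le> real n * saddle n"
    "real n * saddle n = pi * sqrt (real n) / 2"
proof -
  \<comment> \<open>The threshold 16 is chosen so that \<open>pi < 4\<close> makes the saddle point
    at most 1/2.\<close>
  have "sqrt (real n) \<ge> 4" using assms by (intro real_le_rsqrt) auto
  moreover from this have "0 < sqrt (real n)" by linarith
  ultimately show "0 < saddle n" "saddle n \<le> 1 / 2"
    using pi_less_4 by (simp_all add: saddle_def divide_le_eq)
  show *: "real n * saddle n = pi * sqrt (real n) / 2"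
    using assms by (simp add: saddle_def field_simps flip: real_sqrt_mult)
  have "1 * 1 \<le> pi * (sqrt (real n) / 2)"
    using \<open>sqrt (real n) \<ge> 4\<close> pi_ge_two by (intro mult_mono) auto
  then show "1 \<le> real n * saddle n" unfolding * by simp
qed

text \<open>Write t = x \<omega> with \<omega> = 1 + i s sqrt(x). The main terms of the exponent
  equal n x (\<omega> - 1)^2 / \<omega> - (3/2) ln 2 exactly, and n x^2 = pi^2/4. So the Gaussian
  appears without a Taylor expansion: it remains that \<omega> tends to 1 and the error of the
  logarithm to 0.\<close>

lemma normalized_integrand_tendsto:
  "(\<lambda>n. normalized_integrand n s) \<longlonglongrightarrow> of_real (exp (- (pi\<^sup>2 / 4) * s\<^sup>2) / (2 * sqrt 2))"
proof -
  define \<omega> where "\<omega> n = 1 + \<i> * of_real (s * sqrt (saddle n))" for n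
  define t where "t n = of_real (saddle n) * \<omega> n" for n
  define A where "A n = of_real (pi\<^sup>2 / 12) / t n - of_real (ln 2 / 2)" for n
  define L where "L n = (\<Sum>k=1..n. log1pexp (of_nat k * t n))" for n
  \<comment> \<open>The error of \<open>sum_log1pexp_asymp\<close> when \<open>cmod (t n)\<close>
    lies between \<open>saddle n\<close> and twice that, whence 16 is 4 times 2 squared.\<close>
  define e where "e n = 16 * saddle n ^ 2 / (1 - exp (- saddle n))
      + 3 * exp (- real n * saddle n) / saddle n + exp (- real n * saddle n)" for n
  have "(\<lambda>n. s * sqrt (saddle n)) \<longlonglongrightarrow> 0"
    unfolding saddle_def by real_asymp
  note small_lim = this
  have "(\<lambda>n. 1 + \<i> * complex_of_real (s * sqrt (saddle n))) \<longlonglongrightarrow> 1 + \<i> * of_real 0"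
    by (intro tendsto_intros small_lim)
  then have \<omega>_lim: "\<omega> \<longlonglongrightarrow> 1" by (simp add: \<omega>_def[abs_def])
  have small: "\<forall>\<^sub>F n in sequentially. \<bar>s * sqrt (saddle n)\<bar> < 1"
    by (rule order_tendstoD(2)[OF tendsto_rabs_zero[OF small_lim]]) simp
  have "(\<lambda>n. exp (- real n * saddle n)) \<longlonglongrightarrow> 0"
    unfolding saddle_def by real_asymp
  then have small': "\<forall>\<^sub>F n in sequentially. exp (- real n * saddle n) < 1 / 2"
    by (rule order_tendstoD) simp
  have saddle_lim: "filterlim saddle (at_right 0) sequentially"
    unfolding saddle_def by real_asymp
  have "((\<lambda>x. 16 * x ^ 2 / (1 - exp (- x))) \<longlongrightarrow> 0) (at_right (0 :: real))"
    by real_asymp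
  from filterlim_compose[OF this saddle_lim]
  have "(\<lambda>n. 16 * saddle n ^ 2 / (1 - exp (- saddle n))) \<longlonglongrightarrow> 0" .
  moreover have "(\<lambda>n. 3 * exp (- real n * saddle n) / saddle n) \<longlonglongrightarrow> 0"
    unfolding saddle_def by real_asymp
  moreover have "(\<lambda>n. exp (- real n * saddle n)) \<longlonglongrightarrow> 0"
    unfolding saddle_def by real_asymp
  ultimately have e_lim: "e \<longlonglongrightarrow> 0"
    unfolding e_def by (intro tendsto_add_zero)
  have "\<forall>\<^sub>F n in sequentially. cmod (L n - A n) \<le> e n"
    using small small' eventually_ge_at_top[of 16]
  proof eventually_elim
    case (elim n)
    note x = saddle_facts[OF elim(3)]
    have \<omega>: "1 \<le> cmod (\<omega> n)" "cmod (\<omega> n) \<le> 2"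
      using complex_Re_le_cmod[of "\<omega> n"] cmod_le[of "\<omega> n"] elim(1) by (auto simp: \<omega>_def)
    have Re: "Re (t n) = saddle n" and Im: "Im (t n) = saddle n * (s * sqrt (saddle n))"
      by (simp_all add: t_def \<omega>_def)
    have cmod_t: "cmod (t n) = saddle n * cmod (\<omega> n)" using x by (simp add: t_def norm_mult)
    have "cmod (L n - A n) \<le> 4 * cmod (t n) ^ 2 / (1 - exp (- Re (t n)))
        + 3 * exp (- real n * Re (t n)) / cmod (t n) + exp (- real n * Re (t n))"
      unfolding L_def A_def
    proof (rule sum_log1pexp_asymp)
      show "\<bar>Im (t n)\<bar> \<le> Re (t n)"
        unfolding Re Im abs_mult[of "saddle n"] using x elim(1) by (simp add: mult_left_le)
    qed (use x elim Re in auto)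
    also have "\<dots> \<le> 4 * (saddle n * 2) ^ 2 / (1 - exp (- saddle n))
        + 3 * exp (- real n * saddle n) / (saddle n * 1) + exp (- real n * saddle n)"
      unfolding Re cmod_t using x \<omega>
      by (intro add_mono divide_right_mono divide_left_mono mult_left_mono power_mono mult_pos_pos) auto
    finally show ?case by (simp add: e_def power_mult_distrib)
  qed
  from Lim_null_comparison[OF this e_lim] have LA: "(\<lambda>n. L n - A n) \<longlonglongrightarrow> 0" .
  have "(\<lambda>n. exp (3 * (L n - A n)) * exp (of_real (- (3 / 2) * ln 2) - of_real (pi\<^sup>2 / 4 * s\<^sup>2) / \<omega> n))
      \<longlonglongrightarrow> exp (3 * 0) * exp (of_real (- (3 / 2) * ln 2) - of_real (pi\<^sup>2 / 4 * s\<^sup>2) / 1)"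
    by (intro tendsto_intros LA \<omega>_lim) auto
  also have "exp (3 * 0) * exp (of_real (- (3 / 2) * ln 2) - of_real (pi\<^sup>2 / 4 * s\<^sup>2) / 1)
      = complex_of_real (exp (- (3 / 2) * ln 2) * exp (- (pi\<^sup>2 / 4) * s\<^sup>2))"
    by (simp only: mult_zero_right exp_zero mult_1_left div_by_1 of_real_diff[symmetric]
        exp_of_real exp_add[symmetric]) simp
  also have "exp (- (3 / 2) * ln 2) = 1 / (2 * sqrt (2 :: real))"
  proof -
    have "exp (- (3 / 2) * ln 2) = 1 / (2 powr 1 * (2 :: real) powr (1 / 2))"
      unfolding powr_add[symmetric] by (simp add: powr_def exp_minus field_simps)
    then show ?thesis by (simp add: powr_half_sqrt)
  qed
  finally have lim: "(\<lambda>n. exp (3 * (L n - A n)) * exp (of_real (- (3 / 2) * ln 2) - of_real (pi\<^sup>2 / 4 * s\<^sup>2) / \<omega> n))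
      \<longlonglongrightarrow> of_real (exp (- (pi\<^sup>2 / 4) * s\<^sup>2) / (2 * sqrt 2))"
    by simp
  have "\<forall>\<^sub>F n in sequentially. exp (3 * (L n - A n)) * exp (of_real (- (3 / 2) * ln 2) - of_real (pi\<^sup>2 / 4 * s\<^sup>2) / \<omega> n)
      = normalized_integrand n s"
    using eventually_ge_at_top[of 16]
  proof eventually_elim
    case (elim n)
    note x = saddle_facts[OF elim]
    define X where "X = complex_of_real (saddle n)"
    have X0: "X \<noteq> 0" using x by (simp add: X_def)
    have \<omega>0: "\<omega> n \<noteq> 0" by (auto simp: \<omega>_def complex_eq_iff)
    have t: "t n = Complex (saddle n) (s * saddle n powr (3 / 2))"
    proof -
      have "saddle n powr (3 / 2) = saddle n powr (1 + 1 / 2)" by simp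
      also have "\<dots> = saddle n * sqrt (saddle n)"
        unfolding powr_add using x by (simp add: powr_half_sqrt)
      finally show ?thesis by (simp add: t_def \<omega>_def complex_eq_iff)
    qed
    have "exp (L n) = (\<Prod>k=1..n. 1 + exp (- (of_nat k * t n)))"
      unfolding L_def exp_sum[OF finite_atLeastAtMost]
    proof (rule prod.cong)
      fix k assume "k \<in> {1..n}"
      then have "1 + exp (- (of_nat k * t n)) \<notin> \<real>\<^sub>\<le>\<^sub>0"
        using x by (intro one_plus_exp_notin_nonpos) (auto simp: t)
      then show "exp (log1pexp (of_nat k * t n)) = 1 + exp (- (of_nat k * t n))"
        by (intro exp_Ln) auto
    qed simp
    then have eL: "(\<Prod>k=1..n. 1 + exp (- (of_nat k * t n))) ^ 3 = exp (3 * L n)"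
      using exp_of_nat_mult[of 3 "L n"] by simp
    have n: "of_nat n * X\<^sup>2 = of_real (pi\<^sup>2 / 4)"
    proof -
      have "real n * (saddle n)\<^sup>2 = pi\<^sup>2 / 4"
        using elim by (simp add: saddle_def power_divide power_mult_distrib)
      then show ?thesis unfolding X_def by (metis of_real_mult of_real_of_nat_eq of_real_power)
    qed
    have n2: "of_real (pi * sqrt (real n)) = 2 * (of_nat n * X)"
    proof -
      have "pi * sqrt (real n) = 2 * (real n * saddle n)" using x(4) by simp
      then show ?thesis by (simp only: X_def of_real_mult of_real_of_nat_eq of_real_numeral)
    qed
    have \<omega>2: "(\<omega> n - 1)\<^sup>2 = - of_real (s\<^sup>2) * X"
      using x by (simp add: \<omega>_def X_def power_mult_distrib flip: of_real_power)
    have "of_real (- (3 / 2) * ln 2) - of_real (pi\<^sup>2 / 4 * s\<^sup>2) / \<omega> n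
        = 3 * A n + (of_nat n * t n - of_real (pi * sqrt (real n)))"
    proof -
      have "3 * A n = of_nat n * X\<^sup>2 / (X * \<omega> n) - of_real (3 / 2 * ln 2)"
        unfolding A_def n t_def X_def[symmetric] by simp
      also have "of_nat n * X\<^sup>2 / (X * \<omega> n) = of_nat n * X / \<omega> n"
        using X0 by (simp add: power2_eq_square)
      finally have "3 * A n + (of_nat n * t n - of_real (pi * sqrt (real n)))
          = of_nat n * X * (1 / \<omega> n + \<omega> n - 2) - of_real (3 / 2 * ln 2)"
        unfolding n2 t_def X_def[symmetric] by (simp add: algebra_simps)
      also have "1 / \<omega> n + \<omega> n - 2 = (\<omega> n - 1)\<^sup>2 / \<omega> n"
        using \<omega>0 by (simp add: field_simps power2_eq_square)
      also have "of_nat n * X * ((\<omega> n - 1)\<^sup>2 / \<omega> n) = - (of_nat n * X\<^sup>2) * of_real (s\<^sup>2) / \<omega> n"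
        unfolding \<omega>2 by (simp add: power2_eq_square)
      finally show ?thesis unfolding n by simp
    qed
    then have "3 * (L n - A n) + (of_real (- (3 / 2) * ln 2) - of_real (pi\<^sup>2 / 4 * s\<^sup>2) / \<omega> n)
        = 3 * L n + (of_nat n * t n - of_real (pi * sqrt (real n)))"
      by (simp only: right_diff_distrib diff_add_eq_diff_diff_swap) simp
    then show ?case
      unfolding normalized_integrand_def Let_def t[symmetric] eL exp_add[symmetric] by (rule arg_cong)
  qed
  with lim show ?thesis by (rule Lim_transform_eventually)
qed

text \<open>At \<open>s = 0\<close> the product is real and nonnegative and equals the prefactor of
  the bound on the whole circle. So the decay in \<open>s\<close> multiplies
  \<open>cmod (normalized_integrand n 0)\<close>, which is bounded because it converges.\<close>

lemma normalized_integrand_bound: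
  obtains M where "\<And>n s. n \<ge> 16 \<Longrightarrow> \<bar>s * saddle n powr (3 / 2)\<bar> \<le> pi \<Longrightarrow>
    cmod (normalized_integrand n s) \<le> M / (1 + s\<^sup>2)"
proof -
  have "Bseq (\<lambda>n. normalized_integrand n 0)"
    by (rule convergent_imp_Bseq[OF convergentI[OF normalized_integrand_tendsto]])
  then obtain M where M: "\<And>n. cmod (normalized_integrand n 0) \<le> M"
    by (auto simp: Bseq_def)
  have "cmod (normalized_integrand n s) \<le> (M * 14155776) / (1 + s\<^sup>2)"
    if n: "n \<ge> 16" and s: "\<bar>s * saddle n powr (3 / 2)\<bar> \<le> pi" for n s
  proof -
    note x = saddle_facts[OF n]
    define P where "P = (\<Prod>k=1..n. 1 + exp (- (real k * saddle n))) ^ 3"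
    have "P \<ge> 0" unfolding P_def by (intro zero_le_power prod_nonneg) (auto intro: add_nonneg_nonneg)
    have "(\<Prod>k=1..n. 1 + exp (- (of_nat k * Complex (saddle n) 0))) ^ 3 = complex_of_real P"
      by (simp add: P_def Complex_eq flip: exp_of_real)
    then have 0: "cmod (normalized_integrand n 0) = P * exp (real n * saddle n - pi * sqrt (real n))"
      using \<open>P \<ge> 0\<close> by (simp add: normalized_integrand_def Let_def norm_mult)
    have "cmod (normalized_integrand n s) =
        cmod (\<Prod>k=1..n. 1 + exp (- (of_nat k * Complex (saddle n) (s * saddle n powr (3 / 2))))) ^ 3
          * exp (real n * saddle n - pi * sqrt (real n))"
      by (simp add: normalized_integrand_def Let_def norm_mult norm_power)
    also have "\<dots> \<le> P * (14155776 / (1 + s\<^sup>2)) * exp (real n * saddle n - pi * sqrt (real n))"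
      unfolding P_def
      by (intro mult_right_mono norm_prod_one_plus_exp_cubed_le) (use x s in auto)
    also have "\<dots> = cmod (normalized_integrand n 0) * (14155776 / (1 + s\<^sup>2))"
      unfolding 0 by simp
    also have "\<dots> \<le> M * (14155776 / (1 + s\<^sup>2))"
      by (intro mult_right_mono M) (auto intro: add_nonneg_nonneg)
    finally show ?thesis by simp
  qed
  then show ?thesis by (rule that)
qed

lemma integral_normalized_integrand_tendsto:
  "(\<lambda>n. \<integral>s. indicator {-pi..pi} (s * saddle n powr (3 / 2)) *\<^sub>R normalized_integrand n s \<partial>lborel)
    \<longlonglongrightarrow> of_real (1 / sqrt (2 * pi))"
proof -
  define H where "H n s = indicator {-pi..pi} (s * saddle n powr (3 / 2)) *\<^sub>R normalized_integrand n s" for n s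
  define G where "G s = complex_of_real (exp (- (pi\<^sup>2 / 4) * s\<^sup>2) / (2 * sqrt 2))" for s
  obtain M where M: "\<And>n s. n \<ge> 16 \<Longrightarrow> \<bar>s * saddle n powr (3 / 2)\<bar> \<le> pi \<Longrightarrow>
      cmod (normalized_integrand n s) \<le> M / (1 + s\<^sup>2)"
    using normalized_integrand_bound by blast
  \<comment> \<open>Where the indicator vanishes, the majorant still has to be nonnegative.\<close>
  have "0 \<le> M" using order.trans[OF norm_ge_zero M[of 16 0]] by simp
  \<comment> \<open>Shifting by 16 makes the majorant valid for every index;
    \<open>LIMSEQ_offset\<close> undoes the shift.\<close>
  have "(\<lambda>n. integral\<^sup>L lborel (H (n + 16))) \<longlonglongrightarrow> integral\<^sup>L lborel G"
  proof (rule integral_dominated_convergence)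
    show "integrable lborel (\<lambda>s::real. M / (1 + s\<^sup>2))" by (rule integrable_divide_1_plus_square)
    show "AE s in lborel. cmod (H (n + 16) s) \<le> M / (1 + s\<^sup>2)" for n
      using M[of "n + 16"] \<open>0 \<le> M\<close> by (intro AE_I2) (auto simp: H_def indicator_def abs_le_iff)
    show "AE s in lborel. (\<lambda>n. H (n + 16) s) \<longlonglongrightarrow> G s"
    proof (intro AE_I2)
      fix s
      have "(\<lambda>n. s * saddle n powr (3 / 2)) \<longlonglongrightarrow> 0" unfolding saddle_def by real_asymp
      then have "\<forall>\<^sub>F n in sequentially. \<bar>s * saddle n powr (3 / 2)\<bar> < pi"
        by (intro order_tendstoD(2)[OF tendsto_rabs_zero]) auto
      then have "\<forall>\<^sub>F n in sequentially. normalized_integrand n s = H n s"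
        by eventually_elim (auto simp: H_def indicator_def abs_less_iff)
      with normalized_integrand_tendsto[of s] have "(\<lambda>n. H n s) \<longlonglongrightarrow> G s"
        unfolding G_def by (rule Lim_transform_eventually)
      then show "(\<lambda>n. H (n + 16) s) \<longlonglongrightarrow> G s" by (rule LIMSEQ_ignore_initial_segment)
    qed
    show "G \<in> borel_measurable lborel" unfolding G_def by measurable
    show "H (n + 16) \<in> borel_measurable lborel" for n
    proof -
      have "continuous_on UNIV (normalized_integrand (n + 16))"
        unfolding normalized_integrand_def Let_def Complex_eq by (intro continuous_intros)
      then have [measurable]: "normalized_integrand (n + 16) \<in> borel_measurable borel"
        by (rule borel_measurable_continuous_onI)
      show ?thesis unfolding H_def by measurable
    qed
  qed
  moreover have "integral\<^sup>L lborel G = of_real (1 / sqrt (2 * pi))"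
  proof -
    have "sqrt (pi / (pi\<^sup>2 / 4)) = 2 / sqrt pi"
      by (simp add: power2_eq_square real_sqrt_divide)
    then have "(\<integral>s. exp (- (pi\<^sup>2 / 4) * s\<^sup>2) \<partial>lborel) = 2 / sqrt pi"
      using integral_gaussian[of "pi\<^sup>2 / 4"] by simp
    then show ?thesis unfolding G_def integral_complex_of_real by (simp add: real_sqrt_mult)
  qed
  ultimately have "(\<lambda>n. integral\<^sup>L lborel (H (n + 16))) \<longlonglongrightarrow> of_real (1 / sqrt (2 * pi))" by simp
  then show ?thesis unfolding H_def by (rule LIMSEQ_offset)
qed

theorem theorem1p2:
  shows "(\<lambda>n::nat. real (sigma_overline_mex n)) \<sim>[sequentially]
           (\<lambda>n::nat. exp (pi * sqrt (real n)) / (8 * real n powr (3 / 4)))"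
proof (rule asymp_equivI')
  define J where "J n = (\<integral>s. indicator {-pi..pi} (s * saddle n powr (3 / 2)) *\<^sub>R normalized_integrand n s \<partial>lborel)" for n
  define r where "r n = real (sigma_overline_mex n) / (exp (pi * sqrt (real n)) / (8 * real n powr (3 / 4)))" for n
  have c: "(pi / 2) powr (3 / 2) = pi * sqrt (2 * pi) / 4"
  proof -
    have "(pi / 2) powr (3 / 2) = (pi / 2) powr (1 + 1 / 2)" by simp
    also have "\<dots> = pi / 2 * sqrt (2 * pi / 2\<^sup>2)"
      unfolding powr_add by (simp add: powr_half_sqrt)
    also have "sqrt (2 * pi / 2\<^sup>2) = sqrt (2 * pi) / 2"
      unfolding real_sqrt_divide by simp
    finally show ?thesis by simp
  qed
  have "\<forall>\<^sub>F n in sequentially. of_real (sqrt (2 * pi)) * J n = complex_of_real (r n)"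
    using eventually_gt_at_top[of 0]
  proof eventually_elim
    case (elim n)
    have "saddle n powr (3 / 2) = (pi / 2) powr (3 / 2) / real n powr (3 / 4)"
    proof -
      have "saddle n = (pi / 2) / real n powr (1 / 2)"
        by (simp add: saddle_def powr_half_sqrt)
      then show ?thesis using elim by (simp add: powr_divide powr_mult powr_powr)
    qed
    \<comment> \<open>Divided by the claimed asymptotics, the prefactor of the integral is the
      constant \<open>sqrt (2 * pi)\<close>, the reciprocal of the limit of
      \<open>J\<close>.\<close>
    then have "saddle n powr (3 / 2) * (8 * real n powr (3 / 4)) / (2 * pi) = sqrt (2 * pi)"
      using elim by (simp add: c field_simps)
    then have "of_real (sqrt (2 * pi)) * J n = of_real (saddle n powr (3 / 2) * exp (pi * sqrt (real n)) / (2 * pi)) * J n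
        / of_real (exp (pi * sqrt (real n)) / (8 * real n powr (3 / 4)))"
      by (simp flip: \<open>_ = sqrt (2 * pi)\<close>)
    also have "\<dots> = of_nat (sigma_overline_mex n) / of_real (exp (pi * sqrt (real n)) / (8 * real n powr (3 / 4)))"
      unfolding J_def sigma_overline_mex_eq_integral[OF elim] ..
    finally show ?case by (simp add: r_def)
  qed
  moreover have "(\<lambda>n. of_real (sqrt (2 * pi)) * J n) \<longlonglongrightarrow> of_real (sqrt (2 * pi)) * of_real (1 / sqrt (2 * pi))"
    unfolding J_def by (intro tendsto_intros integral_normalized_integrand_tendsto)
  then have "(\<lambda>n. of_real (sqrt (2 * pi)) * J n) \<longlonglongrightarrow> of_real 1"
    by (simp flip: of_real_mult)
  ultimately have "(\<lambda>n. complex_of_real (r n)) \<longlonglongrightarrow> of_real 1"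
    by (rule Lim_transform_eventually[rotated])
  then show "r \<longlonglongrightarrow> 1" unfolding tendsto_of_real_iff .
qed

end
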